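(* The following four statements hold. (1) Let $\mu$ and $\nu$ be symmetric unimodal probability measures on $\mathbb{T}$. Then $\mu\circledast\nu$ is symmetric and unimodal. (2) Let $\varphi\in(0,\pi/2)$ and let $\mu$ be a symmetric probability measure on $\mathbb{T}$ supported on $\{e^{i\theta}:\theta\in[-\varphi,\varphi]\}$. Put $r_\varphi=(\cos\varphi)/4$. Then $\mathbf{p}_{r,\psi}\circledast\mu$ is unimodal for all $r\in(0,r_\varphi)$ and all $\psi\in\mathbb{R}$. (3) Let $\mathbf{b}=\frac12(\delta_{-1}+\delta_1)$. For every $r\in(0,1)$ and $\psi\in\mathbb{R}$, the (continuous) density $f$ of $\mathbf{p}_{r,\psi}\circledast\mathbf{b}$ attains a strict maximum at the two points $\pm e^{i\psi}\in\mathbb{T}$, that is, $f(\xi)<f(e^{i\psi})=f(-e^{i\psi})$ for all $\xi\in\mathbb{T}\setminus\{e^{i\psi},-e^{i\psi}\}$; hence $\mathbf{p}_{r,\psi}\circledast\mathbf{b}$ is not unimodal for any $r\in(0,1)$. (4) There exists some $r_0\in(0,1)$ such that $\mathbf{p}_{r,\psi}$ is not strongly unimodal for any $r\in(r_0,1)$ and any $\psi\in\mathbb{R}$.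
   Context: $\mathbb{T}$ is the unit circle in $\mathbb{C}$, identified with $\mathbb{R}/2\pi\mathbb{Z}$ (often written $[-\pi,\pi)$) via $\theta\mapsto e^{i\theta}$. Densities on $\mathbb{T}$ are with respect to $d\theta$. Classical multiplicative convolution: $\mu\circledast\nu$ is the distribution of the product of two independent $\mathbb{T}$-valued random variables with distributions $\mu$ and $\nu$. Poisson kernel: for $r\in[0,1)$ and $\psi\in\mathbb{R}$, $\mathbf{p}_{r,\psi}$ is the probability measure on $\mathbb{T}$ with density $\frac{d\mathbf{p}_{r,\psi}}{d\theta}(\theta)=\frac{1-r^2}{2\pi|1-re^{i(\theta-\psi)}|^2}$, $\theta\in[-\pi,\pi)$. Symmetric: a probability measure $\mu$ on $\mathbb{T}$ is symmetric if $\mu(B)=\mu(\overline{B})$ for all Borel sets $B\subset\mathbb{T}$, where $\overline B=\{\overline\xi:\xi\in B\}$. Unimodal: a probability measure $\mu$ on $\mathbb{T}$ is unimodal (with mode $\phi$ and antimode $\psi$) if there are $\phi,\psi\in\mathbb{R}$ with $0\le\phi-\psi\le2\pi$, a constant $c\ge0$ and a function $f:(\psi,\psi+2\pi)\to[0,\infty)$, non-decreasing on $(\psi,\phi)$ and non-increasing on $(\phi,\psi+2\pi)$, such that $\mu(d\theta)=c\,\delta_\phi+f(\theta)\,d\theta$. Strongly unimodal: $\mu$ is strongly unimodal if $\mu\circledast\nu$ is unimodal for every unimodal probability measure $\nu$ on $\mathbb{T}$. *)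

theory Defs
  imports "HOL-Probability.Probability"
begin

text \<open>
  The circle is the unit sphere of the complex plane with its trace Borel \<sigma>-algebra;
  \<^term>\<open>cis \<theta>\<close> is the point with angle \<open>\<theta>\<close>.
\<close>

definition circle_borel :: "complex measure" where
  "circle_borel = restrict_space borel (sphere 0 1)"

definition circle_prob :: "complex measure \<Rightarrow> bool" where
  "circle_prob \<mu> \<longleftrightarrow> prob_space \<mu> \<and> sets \<mu> = sets circle_borel"

definition circle_conv :: "complex measure \<Rightarrow> complex measure \<Rightarrow> complex measure"
    (infixl "\<circledast>" 70) where
  "\<mu> \<circledast> \<nu> = distr (\<mu> \<Otimes>\<^sub>M \<nu>) circle_borel (\<lambda>(x, y). x * y)"

text \<open>
  The measure \<open>f(\<theta>) d\<theta>\<close> on the circle, where the angle \<open>\<theta>\<close> ranges over a Borel set \<open>I\<close> of reals.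
  It is meant for \<open>I\<close> contained in an interval of length \<open>2\<pi>\<close> and for \<open>f\<close> nonnegative and Borel on \<open>I\<close>.
\<close>

definition angle_density :: "real set \<Rightarrow> (real \<Rightarrow> real) \<Rightarrow> complex measure" where
  "angle_density I f =
     distr (density (restrict_space lborel I) (\<lambda>\<theta>. ennreal (f \<theta>))) circle_borel cis"

definition add_measure :: "'a measure \<Rightarrow> 'a measure \<Rightarrow> 'a measure" where
  "add_measure M N = measure_of (space M) (sets M) (\<lambda>B. emeasure M B + emeasure N B)"

lemma sets_add_measure [simp]: "sets (add_measure M N) = sets M"
  by (simp add: add_measure_def)

lemma space_add_measure [simp]: "space (add_measure M N) = space M"
  by (simp add: add_measure_def)

lemma emeasure_add_measure:
  assumes "sets N = sets M" and "B \<in> sets M"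
  shows "emeasure (add_measure M N) B = emeasure M B + emeasure N B"
  using add_measure_def
proof (rule emeasure_measure_of)
  show "sets M \<subseteq> Pow (space M)"
    by (rule sets.space_closed)
  show "positive (sets (add_measure M N)) (\<lambda>B. emeasure M B + emeasure N B)"
    by (simp add: positive_def)
  show "countably_additive (sets (add_measure M N)) (\<lambda>B. emeasure M B + emeasure N B)"
    using assms(1) by (intro countably_additiveI) (auto simp: suminf_add[symmetric] suminf_emeasure)
  show "B \<in> sets (add_measure M N)"
    using assms(2) by simp
qed

definition poisson_kernel :: "real \<Rightarrow> real \<Rightarrow> complex measure" where
  "poisson_kernel r \<psi> =
     angle_density {-pi..<pi}
       (\<lambda>\<theta>. (1 - r\<^sup>2) / (2 * pi * (cmod (1 - complex_of_real r * cis (\<theta> - \<psi>)))\<^sup>2))"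

definition circle_symmetric :: "complex measure \<Rightarrow> bool" where
  "circle_symmetric \<mu> \<longleftrightarrow> (\<forall>B \<in> sets circle_borel. emeasure \<mu> B = emeasure \<mu> (cnj ` B))"

text \<open>
  The value \<open>f \<phi>\<close> at the mode is unconstrained, apart from being nonnegative when \<open>\<phi>\<close> is interior.
  The monotonicity conditions make \<open>f\<close> Borel on the interval.
\<close>

definition circle_unimodal :: "complex measure \<Rightarrow> bool" where
  "circle_unimodal \<mu> \<longleftrightarrow>
     (\<exists>\<phi> \<psi> c f. 0 \<le> \<phi> - \<psi> \<and> \<phi> - \<psi> \<le> 2 * pi \<and> 0 \<le> c \<and>
        (\<forall>\<theta> \<in> {\<psi><..<\<psi> + 2 * pi}. 0 \<le> f \<theta>) \<and>
        mono_on {\<psi><..<\<phi>} f \<and> antimono_on {\<phi><..<\<psi> + 2 * pi} f \<and>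
        \<mu> = add_measure (scale_measure (ennreal c) (return circle_borel (cis \<phi>)))
                         (angle_density {\<psi><..<\<psi> + 2 * pi} f))"

definition strongly_unimodal :: "complex measure \<Rightarrow> bool" where
  "strongly_unimodal \<mu> \<longleftrightarrow>
     (\<forall>\<nu>. circle_prob \<nu> \<longrightarrow> circle_unimodal \<nu> \<longrightarrow> circle_unimodal (\<mu> \<circledast> \<nu>))"

definition sym_bernoulli :: "complex measure" where
  "sym_bernoulli =
     scale_measure (1 / 2) (add_measure (return circle_borel (- 1)) (return circle_borel 1))"

definition continuous_density :: "complex measure \<Rightarrow> (complex \<Rightarrow> real) \<Rightarrow> bool" where
  "continuous_density \<mu> f \<longleftrightarrow>
     continuous_on (sphere 0 1) f \<and> (\<forall>\<xi> \<in> sphere 0 1. 0 \<le> f \<xi>) \<and>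
     \<mu> = angle_density {-pi..<pi} (\<lambda>\<theta>. f (cis \<theta>))"

end

theory Submission
  imports Defs
begin

text \<open>Unimodality determines a density only up to null sets, and its mode is not unique: on a
  plateau, for instance for the uniform density, a symmetric measure may come with a mode off the
  real axis. Symmetry can therefore not be read off the given data. Every measure is reduced to one
  atom plus a density on the circle that is known almost everywhere; a symmetric one is compared
  with its own conjugate, and the inequalities obtained at almost all points are extended to all
  points. For the same reason the negative results test open sets of angles instead of single
  angles. The factor \<open>s\<close> in (1) is unavoidable, because a symmetric mode can be -1;
  under convolution these signs multiply. The measure in (4) comes from a limit. At its own scale
  the Poisson kernel tends to a Cauchy density as r tends to 1, and the convolution with an atom and
  an arc starting at it looks, up to constants, like a / (1 + x^2) + arctan x. The derivative has
  the sign of x^2 - 2 a x + 1, so for a > 1 there is a dip to the right of the peak. The constants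
  are chosen so that the dip survives all error terms for r > 99/100.\<close>

text \<open>
  (1) A symmetric unimodal measure is an atom at \<open>s = 1\<close> or \<open>s = -1\<close> plus a density that is a
  nondecreasing function of \<open>Re (s z)\<close>. For two such densities \<open>F, G\<close> and \<open>x, y\<close> on the circle, the
  reflection \<open>w \<mapsto> x y cnj w\<close> exchanges \<open>F (x cnj w)\<close> with \<open>F (y cnj w)\<close>, so comparing the
  convolution at \<open>x\<close> and \<open>y\<close> reduces to a pointwise rearrangement inequality.

  (2) By symmetry it suffices that \<open>P (x - t) + P (x + t)\<close> is nondecreasing in \<open>cos x\<close>, where \<open>P\<close> is
  the Poisson kernel. This sum is a quotient of polynomials in \<open>cos x\<close>, and the condition
  \<open>4 r \<le> cos t\<close> gives the sign of the differences.

  (3), (4) A unimodal density cannot be large, small, large, small at four points in cyclic order.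
  For (4) the Poisson kernel is convolved with a point mass at the end point of a quarter
  circle plus arc length on it: the density has one peak from the atom and another one inside the arc.
\<close>

section \<open>Arc length on the circle\<close>

lemma space_circle_borel [simp]: "space circle_borel = sphere 0 1"
  by (simp add: circle_borel_def space_restrict_space)

lemma measurable_circle_borel_iff:
  "f \<in> measurable M circle_borel \<longleftrightarrow> f \<in> borel_measurable M \<and> (\<forall>x\<in>space M. cmod (f x) = 1)"
  unfolding circle_borel_def by (auto simp: measurable_restrict_space2_iff)

lemma circle_borel_measurableD [measurable_dest]:
  "f \<in> measurable M circle_borel \<Longrightarrow> f \<in> borel_measurable M"
  by (simp add: measurable_circle_borel_iff)

lemma measurable_circle_id [measurable]: "(\<lambda>x. x) \<in> borel_measurable circle_borel"
  by (simp add: circle_borel_def measurable_restrict_space1)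

lemma measurable_circle_const [measurable]:
  "cmod z = 1 \<Longrightarrow> (\<lambda>x. z) \<in> measurable M circle_borel"
  by (simp add: measurable_circle_borel_iff)

lemma measurable_circle_cis [measurable]:
  "f \<in> borel_measurable M \<Longrightarrow> (\<lambda>x. cis (f x)) \<in> measurable M circle_borel"
  unfolding measurable_circle_borel_iff
  by (auto intro!: borel_measurable_continuous_on[where f = cis] continuous_intros)

lemma measurable_circle_mult [measurable (raw)]:
  assumes [measurable]: "f \<in> measurable M circle_borel" "g \<in> measurable M circle_borel"
  shows "(\<lambda>x. f x * g x) \<in> measurable M circle_borel"
  using assms by (simp add: measurable_circle_borel_iff norm_mult)

lemma measurable_circle_cnj [measurable (raw)]:
  assumes [measurable]: "f \<in> measurable M circle_borel"
  shows "(\<lambda>x. cnj (f x)) \<in> measurable M circle_borel"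
  using assms unfolding measurable_circle_borel_iff
  by (auto intro!: borel_measurable_continuous_on[where f = cnj] continuous_intros)

lemma borel_measurable_circleI:
  "f \<in> borel_measurable borel \<Longrightarrow> f \<in> borel_measurable circle_borel"
  unfolding circle_borel_def by (rule measurable_restrict_space1)

text \<open>Arc length lives on the circle itself and not on an interval of angles, so that
  densities are functions of z and rotations and reflections need no reduction modulo
  \<open>2 * pi\<close>.\<close>

definition arc_measure :: "complex measure" where
  "arc_measure = distr (restrict_space lborel {-pi..<pi}) circle_borel cis"

lemma sets_arc_measure [simp, measurable_cong]: "sets arc_measure = sets circle_borel"
  by (simp add: arc_measure_def)

lemma space_arc_measure [simp]: "space arc_measure = sphere 0 1"
  by (simp add: arc_measure_def)

lemma nn_integral_arc:
  assumes [measurable]: "G \<in> borel_measurable circle_borel"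
  shows "(\<integral>\<^sup>+z. G z \<partial>arc_measure) = (\<integral>\<^sup>+t. G (cis t) * indicator {-pi..<pi} t \<partial>lborel)"
proof -
  have [measurable]: "cis \<in> restrict_space lborel {-pi..<pi} \<rightarrow>\<^sub>M circle_borel"
    by (intro measurable_restrict_space1) measurable
  show ?thesis
    unfolding arc_measure_def
    by (subst nn_integral_distr) (auto simp: nn_integral_restrict_space)
qed

lemma nn_integral_lborel_shift:
  fixes f :: "real \<Rightarrow> ennreal"
  assumes [measurable]: "f \<in> borel_measurable borel"
  shows "(\<integral>\<^sup>+t. f t \<partial>lborel) = (\<integral>\<^sup>+t. f (a + t) \<partial>lborel)"
  using nn_integral_real_affine[OF assms, of 1 a] by simp

lemma cis_add_2pi_int [simp]: "cis (t + 2 * pi * of_int k) = cis t" "cis (2 * pi * of_int k + t) = cis t"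
  by (simp_all flip: cis_mult add: cis_multiple_2pi)

text \<open>Full turns move the start of the window to some \<open>b\<close> in [-pi, pi). The part
  of the window beyond \<open>pi\<close> is then moved back by one turn and fills the gap from
  \<open>-pi\<close> to \<open>b\<close>.\<close>

lemma nn_integral_arc_window:
  assumes [measurable]: "G \<in> borel_measurable circle_borel"
  shows "(\<integral>\<^sup>+z. G z \<partial>arc_measure) = (\<integral>\<^sup>+t. G (cis t) * indicator {a..<a + 2 * pi} t \<partial>lborel)"
proof -
  define k where "k = \<lfloor>(a + pi) / (2 * pi)\<rfloor>"
  define b where "b = a - 2 * pi * of_int k"
  have "of_int k \<le> (a + pi) / (2 * pi)" "(a + pi) / (2 * pi) < of_int k + 1"
    unfolding k_def by linarith+
  then have b: "-pi \<le> b" "b < pi"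
    using pi_gt_zero unfolding b_def by (auto simp: field_simps)
  \<comment> \<open>\<open>A\<close> is a family of sets in which \<open>A j\<close> is
    \<open>A 0\<close> moved by \<open>j\<close> full turns. It is used once for whole windows and
    once for the part beyond \<open>pi\<close>.\<close>
  have shift: "(\<integral>\<^sup>+t. G (cis t) * indicator (A j) t \<partial>lborel) = (\<integral>\<^sup>+t. G (cis t) * indicator (A 0) t \<partial>lborel)"
    if "\<And>j t. 2 * pi * of_int j + t \<in> A j \<longleftrightarrow> t \<in> A 0" "A j \<in> sets borel" for A :: "int \<Rightarrow> real set" and j
    using that(2)
    by (subst nn_integral_lborel_shift[where a = "2 * pi * of_int j"])
       (auto simp: that(1) indicator_def intro!: nn_integral_cong)
  have 1: "(\<integral>\<^sup>+t. G (cis t) * indicator {a..<a + 2 * pi} t \<partial>lborel)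
      = (\<integral>\<^sup>+t. G (cis t) * indicator {b..<b + 2 * pi} t \<partial>lborel)"
    using shift[of "\<lambda>j. {b + 2 * pi * of_int j..<b + 2 * pi * of_int j + 2 * pi}" k]
    by (simp add: b_def algebra_simps)
  have 2: "(\<integral>\<^sup>+t. G (cis t) * indicator {pi..<b + 2 * pi} t \<partial>lborel)
      = (\<integral>\<^sup>+t. G (cis t) * indicator {-pi..<b} t \<partial>lborel)"
    using shift[of "\<lambda>j. {2 * pi * of_int j - pi..<b + 2 * pi * of_int j}" 1] by simp
  have "(\<integral>\<^sup>+t. G (cis t) * indicator {b..<b + 2 * pi} t \<partial>lborel)
      = (\<integral>\<^sup>+t. G (cis t) * indicator {b..<pi} t + G (cis t) * indicator {pi..<b + 2 * pi} t \<partial>lborel)"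
    using b by (intro nn_integral_cong) (auto simp: indicator_def)
  also have "\<dots> = (\<integral>\<^sup>+t. G (cis t) * indicator {b..<pi} t \<partial>lborel) + (\<integral>\<^sup>+t. G (cis t) * indicator {-pi..<b} t \<partial>lborel)"
    by (subst nn_integral_add) (auto simp: 2)
  also have "\<dots> = (\<integral>\<^sup>+t. G (cis t) * indicator {b..<pi} t + G (cis t) * indicator {-pi..<b} t \<partial>lborel)"
    by (subst nn_integral_add) auto
  also have "\<dots> = (\<integral>\<^sup>+t. G (cis t) * indicator {-pi..<pi} t \<partial>lborel)"
    using b by (intro nn_integral_cong) (auto simp: indicator_def)
  finally show ?thesis
    by (simp add: nn_integral_arc 1)
qed

lemma nn_integral_arc_Ioo:
  assumes [measurable]: "G \<in> borel_measurable circle_borel"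
  shows "(\<integral>\<^sup>+z. G z \<partial>arc_measure) = (\<integral>\<^sup>+t. G (cis t) * indicator {a<..<a + 2 * pi} t \<partial>lborel)"
  unfolding nn_integral_arc_window[OF assms, of a]
  using AE_lborel_singleton[of a]
  by (intro nn_integral_cong_AE) (auto simp: indicator_def elim!: eventually_mono)

lemma circle_norm_cisE:
  assumes "cmod z = 1" obtains t where "z = cis t" "-pi < t" "t \<le> pi"
  using assms cis_Arg[of z] Arg_bounded[of z]
  by (metis norm_zero sgn_div_norm div_by_1 scaleR_one inverse_1 zero_neq_one)

lemma nn_integral_arc_mult:
  assumes G [measurable]: "G \<in> borel_measurable circle_borel" and "cmod z = 1"
  shows "(\<integral>\<^sup>+w. G (z * w) \<partial>arc_measure) = (\<integral>\<^sup>+w. G w \<partial>arc_measure)"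
proof -
  obtain a where z: "z = cis a" using \<open>cmod z = 1\<close> by (rule circle_norm_cisE)
  have "(\<integral>\<^sup>+w. G w \<partial>arc_measure) = (\<integral>\<^sup>+t. G (cis t) * indicator {a - pi..<pi + a} t \<partial>lborel)"
    using nn_integral_arc_window[OF G, of "a - pi"] by (simp add: algebra_simps)
  also have "\<dots> = (\<integral>\<^sup>+t. G (z * cis t) * indicator {-pi..<pi} t \<partial>lborel)"
    by (subst nn_integral_lborel_shift[where a = a])
       (auto simp: z cis_mult indicator_def intro!: nn_integral_cong)
  also have "\<dots> = (\<integral>\<^sup>+w. G (z * w) \<partial>arc_measure)"
    using \<open>cmod z = 1\<close> by (subst nn_integral_arc) auto
  finally show ?thesis by simp
qed

text \<open>The open window (-pi, pi) is invariant under t -> -t, which the half-open one is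
  not.\<close>

lemma nn_integral_arc_cnj:
  assumes G [measurable]: "G \<in> borel_measurable circle_borel"
  shows "(\<integral>\<^sup>+w. G (cnj w) \<partial>arc_measure) = (\<integral>\<^sup>+w. G w \<partial>arc_measure)"
proof -
  have "(\<integral>\<^sup>+w. G w \<partial>arc_measure) = (\<integral>\<^sup>+t. G (cis t) * indicator {-pi<..<pi} t \<partial>lborel)"
    using nn_integral_arc_Ioo[OF G, of "-pi"] by simp
  also have "\<dots> = (\<integral>\<^sup>+t. G (cnj (cis t)) * indicator {-pi<..<pi} t \<partial>lborel)"
    by (subst nn_integral_real_affine[where c = "-1" and t = 0])
       (auto simp: indicator_def cis_cnj intro!: nn_integral_cong)
  also have "\<dots> = (\<integral>\<^sup>+w. G (cnj w) \<partial>arc_measure)"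
    using nn_integral_arc_Ioo[of "\<lambda>w. G (cnj w)" "-pi"] by simp
  finally show ?thesis by simp
qed

lemma nn_integral_arc_reflect:
  assumes [measurable]: "G \<in> borel_measurable circle_borel" and "cmod z = 1"
  shows "(\<integral>\<^sup>+w. G (z * cnj w) \<partial>arc_measure) = (\<integral>\<^sup>+w. G w \<partial>arc_measure)"
  using assms(2) nn_integral_arc_cnj[of "\<lambda>w. G (z * w)"] nn_integral_arc_mult[of G z] by simp

lemma emeasure_arc_space: "emeasure arc_measure (sphere 0 1) = ennreal (2 * pi)"
proof -
  have "emeasure arc_measure (sphere 0 1) = (\<integral>\<^sup>+z. 1 \<partial>arc_measure)" by simp
  also have "\<dots> = ennreal (2 * pi)"
    by (subst nn_integral_arc) auto
  finally show ?thesis .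
qed

lemma finite_measure_arc: "finite_measure arc_measure"
  by (rule finite_measureI) (simp add: emeasure_arc_space)

lemma cis_inj_window:
  assumes "cis t = cis a" "\<bar>t - a\<bar> < 2 * pi" shows "t = a"
proof (rule ccontr)
  assume "t \<noteq> a"
  have "cis (t - a) = 1" using assms(1) by (simp flip: cis_divide)
  then have "cos (t - a) = 1" by (metis cis.sel(1) one_complex.sel(1))
  then have "cos \<bar>t - a\<bar> = 1" by (metis cos_abs_real)
  then have "sin (\<bar>t - a\<bar> / 2) = 0"
    using cos_double_sin[of "\<bar>t - a\<bar> / 2"] by simp
  moreover have "sin (\<bar>t - a\<bar> / 2) > 0"
    using assms(2) \<open>t \<noteq> a\<close> by (intro sin_gt_zero) auto
  ultimately show False by simp
qed

text \<open>The open window that starts at the angle of \<open>z\<close> avoids \<open>z\<close>, so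
  the integrand vanishes identically there.\<close>

lemma arc_measure_singleton: 
  assumes "cmod z = 1" shows "emeasure arc_measure {z} = 0"
proof -
  obtain a where z: "z = cis a" using \<open>cmod z = 1\<close> by (rule circle_norm_cisE)
  have m: "{z} \<in> sets circle_borel" using assms by (auto simp: circle_borel_def sets_restrict_space image_iff intro!: bexI[of _ "{z}"])
  have ne: "cis t \<noteq> cis a" if "a < t" "t < a + 2 * pi" for t
    using cis_inj_window[of t a] that by auto
  have "emeasure arc_measure {z} = (\<integral>\<^sup>+w. indicator {z} w \<partial>arc_measure)" using m by simp
  also have "\<dots> = (\<integral>\<^sup>+t. indicator {z} (cis t) * indicator {a<..<a + 2 * pi} t \<partial>lborel)"
    using m by (intro nn_integral_arc_Ioo) simp
  also have "\<dots> = (\<integral>\<^sup>+(t::real). 0 \<partial>lborel)"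
    by (rule nn_integral_cong) (auto simp: z ne split: split_indicator)
  finally show ?thesis by simp
qed

section \<open>Densities with an atom\<close>

text \<open>\<open>Arg\<close> is continuous off the nonpositive reals and constant on the negative
  ray. This allows densities given in angles to be rewritten as Borel functions of z.\<close>

lemma Arg_borel_measurable [measurable]: "Arg \<in> borel_measurable borel"
proof -
  have "(\<lambda>z. indicator (- \<real>\<^sub>\<le>\<^sub>0) z *\<^sub>R Arg z) \<in> borel_measurable borel"
    by (intro borel_measurable_continuous_on_indicator continuous_on_Arg) auto
  then have "(\<lambda>z. indicator (- \<real>\<^sub>\<le>\<^sub>0) z *\<^sub>R Arg z + pi * indicator (\<real>\<^sub>\<le>\<^sub>0 - {0}) z) \<in> borel_measurable borel"
    by (intro borel_measurable_add borel_measurable_times borel_measurable_indicator) auto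
  also have "(\<lambda>z. indicator (- \<real>\<^sub>\<le>\<^sub>0) z *\<^sub>R Arg z + pi * indicator (\<real>\<^sub>\<le>\<^sub>0 - {0}) z) = Arg"
  proof
    fix z :: complex
    have "Arg z = pi" if "z \<in> \<real>\<^sub>\<le>\<^sub>0" "z \<noteq> 0"
      using that by (auto simp: Arg_eq_pi complex_nonpos_Reals_iff complex_eq_iff)
    then show "indicator (- \<real>\<^sub>\<le>\<^sub>0) z *\<^sub>R Arg z + pi * indicator (\<real>\<^sub>\<le>\<^sub>0 - {0}) z = Arg z"
      by (cases "z \<in> \<real>\<^sub>\<le>\<^sub>0"; cases "z = 0") (simp_all add: Arg_zero)
  qed
  finally show ?thesis .
qed

lemma sets_angle_density [simp, measurable_cong]: "sets (angle_density I f) = sets circle_borel"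
  by (simp add: angle_density_def)

lemma nn_integral_angle_density:
  assumes [measurable]: "G \<in> borel_measurable circle_borel" "I \<in> sets borel"
    and f: "(\<lambda>t. ennreal (f t)) \<in> borel_measurable (restrict_space lborel I)"
  shows "(\<integral>\<^sup>+z. G z \<partial>angle_density I f) = (\<integral>\<^sup>+t. ennreal (f t) * G (cis t) * indicator I t \<partial>lborel)"
proof -
  have [measurable]: "cis \<in> restrict_space lborel I \<rightarrow>\<^sub>M circle_borel"
    by (intro measurable_restrict_space1) measurable
  note f [measurable]
  show ?thesis
    unfolding angle_density_def
    by (subst nn_integral_distr) (auto simp: nn_integral_density nn_integral_restrict_space)
qed

lemma nn_integral_add_measure:
  assumes [measurable_cong]: "sets N = sets M" and "G \<in> borel_measurable M"
  shows "(\<integral>\<^sup>+z. G z \<partial>add_measure M N) = (\<integral>\<^sup>+z. G z \<partial>M) + (\<integral>\<^sup>+z. G z \<partial>N)"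
proof -
  have [simp, measurable_cong]: "sets (add_measure M N) = sets M" by simp
  have sp: "space N = space M" using assms(1) by (rule sets_eq_imp_space_eq)
  show ?thesis using assms(2)
  proof (induction rule: borel_measurable_induct)
    case (cong f g)
    then show ?case by (simp add: sp cong: nn_integral_cong_simp)
  next
    case (set A)
    then show ?case using assms(1) by (simp add: emeasure_add_measure)
  next
    case (mult u c)
    then show ?case by (simp add: nn_integral_cmult distrib_left)
  next
    case (add u v)
    then show ?case by (simp add: nn_integral_add ac_simps)
  next
    case (seq U)
    note [measurable] = seq(1)
    have mono: "incseq (\<lambda>i. integral\<^sup>N M' (U i))" for M'
      using seq(3) by (auto simp: incseq_def le_fun_def intro!: nn_integral_mono)
    have M: "(\<integral>\<^sup>+z. (SUP i. U i) z \<partial>M') = (SUP i. \<integral>\<^sup>+z. U i z \<partial>M')"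
      if [measurable_cong]: "sets M' = sets M" for M'
      using seq(3) by (subst nn_integral_monotone_convergence_SUP[symmetric]) (auto simp: SUP_apply[abs_def] intro!: nn_integral_cong)
    have "(SUP i. integral\<^sup>N M (U i) + integral\<^sup>N N (U i))
        = (SUP i. integral\<^sup>N M (U i)) + (SUP i. integral\<^sup>N N (U i))"
      by (rule ennreal_SUP_add[OF mono mono])
    with seq.IH show ?case
      by (simp only: M[of M] M[of N] M[of "add_measure M N"] assms(1) sets_add_measure)
  qed
qed

text \<open>The common form of all measures that are compared: an atom of weight \<open>c\<close> at
  \<open>s\<close> plus a density. Testing against all nonnegative functions suits Tonelli, and
  values in \<open>ennreal\<close> avoid integrability conditions. For \<open>c = 0\<close> the
  point \<open>s\<close> carries no information.\<close>

definition circle_rep :: "complex measure \<Rightarrow> ennreal \<Rightarrow> complex \<Rightarrow> (complex \<Rightarrow> ennreal) \<Rightarrow> bool" where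
  "circle_rep \<mu> c s F \<longleftrightarrow> sets \<mu> = sets circle_borel \<and> cmod s = 1 \<and> F \<in> borel_measurable circle_borel \<and>
     (\<forall>G\<in>borel_measurable circle_borel. (\<integral>\<^sup>+z. G z \<partial>\<mu>) = c * G s + (\<integral>\<^sup>+z. F z * G z \<partial>arc_measure))"

lemma circle_rep_integral:
  "circle_rep \<mu> c s F \<Longrightarrow> G \<in> borel_measurable circle_borel \<Longrightarrow>
    (\<integral>\<^sup>+z. G z \<partial>\<mu>) = c * G s + (\<integral>\<^sup>+z. F z * G z \<partial>arc_measure)"
  by (auto simp: circle_rep_def)

lemma circle_rep_emeasure:
  "circle_rep \<mu> c s F \<Longrightarrow> A \<in> sets circle_borel \<Longrightarrow>
    emeasure \<mu> A = c * indicator A s + (\<integral>\<^sup>+z. F z * indicator A z \<partial>arc_measure)"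
  using circle_rep_integral[of \<mu> c s F "indicator A"] by (auto simp: circle_rep_def)

lemma circle_rep_cong:
  assumes rep: "circle_rep \<mu> c s F" and eq: "AE z in arc_measure. F z = F' z"
    and s': "c \<noteq> 0 \<Longrightarrow> s = s'" "cmod s' = 1" and F': "F' \<in> borel_measurable circle_borel"
  shows "circle_rep \<mu> c s' F'"
  unfolding circle_rep_def
proof (intro conjI ballI F' s'(2))
  show "sets \<mu> = sets circle_borel" using rep by (simp add: circle_rep_def)
  fix G :: "complex \<Rightarrow> ennreal" assume "G \<in> borel_measurable circle_borel"
  then have "(\<integral>\<^sup>+z. G z \<partial>\<mu>) = c * G s + (\<integral>\<^sup>+z. F z * G z \<partial>arc_measure)"
    by (rule circle_rep_integral[OF rep])
  also have "c * G s = c * G s'"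
    using s'(1) by (cases "c = 0") auto
  also have "(\<integral>\<^sup>+z. F z * G z \<partial>arc_measure) = (\<integral>\<^sup>+z. F' z * G z \<partial>arc_measure)"
    using eq by (intro nn_integral_cong_AE) (auto elim!: eventually_mono)
  finally show "(\<integral>\<^sup>+z. G z \<partial>\<mu>) = c * G s' + (\<integral>\<^sup>+z. F' z * G z \<partial>arc_measure)" .
qed

lemma circle_rep_measure_eqI:
  assumes "circle_rep \<mu> c s F" "circle_rep \<nu> c s F"
  shows "\<mu> = \<nu>"
proof (rule measure_eqI)
  show "sets \<mu> = sets \<nu>" using assms by (simp add: circle_rep_def)
  fix A assume "A \<in> sets \<mu>"
  then have "A \<in> sets circle_borel" using assms by (simp add: circle_rep_def)
  then show "emeasure \<mu> A = emeasure \<nu> A"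
    by (simp add: circle_rep_emeasure[OF assms(1)] circle_rep_emeasure[OF assms(2)])
qed

lemma circle_singleton_sets [measurable]: "cmod s = 1 \<Longrightarrow> {s} \<in> sets circle_borel"
  by (auto simp: circle_borel_def sets_restrict_space image_iff intro!: bexI[of _ "{s}"])

lemma AE_arc_neq: "cmod s = 1 \<Longrightarrow> AE z in arc_measure. z \<noteq> s"
  by (rule AE_I[of _ _ "{s}"]) (auto simp: arc_measure_singleton)

lemma circle_rep_singleton:
  assumes "circle_rep \<mu> c s F" "cmod z = 1"
  shows "emeasure \<mu> {z} = c * indicator {z} s"
proof -
  have "(\<integral>\<^sup>+w. F w * indicator {z} w \<partial>arc_measure) = (\<integral>\<^sup>+w. 0 \<partial>arc_measure)"
    using AE_arc_neq[OF assms(2)] by (intro nn_integral_cong_AE) (auto elim!: eventually_mono)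
  then show ?thesis
    using assms by (subst circle_rep_emeasure[OF assms(1)]) auto
qed

lemma circle_rep_unique_atom:
  assumes "circle_rep \<mu> c s F" "circle_rep \<mu> c' s' F'" "c \<noteq> 0"
  shows "s = s'"
  using circle_rep_singleton[OF assms(1), of s] circle_rep_singleton[OF assms(2), of s] assms
  by (auto simp: circle_rep_def indicator_def split: if_splits)

text \<open>The atoms are not assumed to agree. After both points are cut out, \<open>F\<close> and
  \<open>F'\<close> are densities of the same measure with respect to a finite one, and the removed
  points are null.\<close>

lemma circle_rep_unique_AE:
  assumes rep: "circle_rep \<mu> c s F" "circle_rep \<mu> c' s' F'"
  shows "AE z in arc_measure. F z = F' z"
proof -
  interpret finite_measure arc_measure by (rule finite_measure_arc)
  have [measurable]: "F \<in> borel_measurable circle_borel" "F' \<in> borel_measurable circle_borel"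
    and s: "cmod s = 1" "cmod s' = 1"
    using rep by (auto simp: circle_rep_def)
  define C where "C = sphere 0 1 - ({s} \<union> {s'})"
  have C [measurable]: "C \<in> sets circle_borel"
    unfolding C_def using s sets.top[of circle_borel] by (intro sets.Diff sets.Un circle_singleton_sets) simp_all
  have "AE z in arc_measure. F z * indicator C z = F' z * indicator C z"
  proof (rule density_unique_finite_measure)
    fix A assume "A \<in> sets arc_measure"
    then have [measurable]: "A \<in> sets circle_borel" by simp
    have CA: "C \<inter> A \<in> sets circle_borel" "s \<notin> C \<inter> A" "s' \<notin> C \<inter> A"
      using sets.Int[OF C] by (simp_all add: C_def)
    have "(\<integral>\<^sup>+z. F z * indicator C z * indicator A z \<partial>arc_measure) = emeasure \<mu> (C \<inter> A)"
      unfolding circle_rep_emeasure[OF rep(1) CA(1)] indicator_simps(2)[OF CA(2)]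
      by (simp only: indicator_inter_arith mult.assoc mult_zero_right add_0)
    also have "\<dots> = (\<integral>\<^sup>+z. F' z * indicator C z * indicator A z \<partial>arc_measure)"
      unfolding circle_rep_emeasure[OF rep(2) CA(1)] indicator_simps(2)[OF CA(3)]
      by (simp only: indicator_inter_arith mult.assoc mult_zero_right add_0)
    finally show "(\<integral>\<^sup>+z. F z * indicator C z * indicator A z \<partial>arc_measure) 
        = (\<integral>\<^sup>+z. F' z * indicator C z * indicator A z \<partial>arc_measure)" .
  qed auto
  with AE_arc_neq[OF s(1)] AE_arc_neq[OF s(2)] AE_space show ?thesis
    by eventually_elim (auto simp: C_def)
qed

section \<open>Between unimodal measures and their densities on the circle\<close>

lemma borel_measurable_unimodal:
  fixes f :: "real \<Rightarrow> real"
  assumes "mono_on {a<..<p} f" "antimono_on {p<..<b} f" "a \<le> p" "p \<le> b"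
  shows "(\<lambda>t. f t * indicator {a<..<b} t) \<in> borel_measurable borel"
proof -
  have 1: "(\<lambda>t. f t * indicator {a<..<p} t) \<in> borel_measurable borel"
    using borel_measurable_mono_on_fnc[OF assms(1)]
    by (simp add: borel_measurable_restrict_space_iff mult.commute)
  have "mono_on {p<..<b} (\<lambda>t. - f t)"
    using assms(2) by (auto simp: monotone_on_def)
  from borel_measurable_mono_on_fnc[OF this]
  have "(\<lambda>t. - (- f t * indicator {p<..<b} t)) \<in> borel_measurable borel"
    by (intro borel_measurable_uminus) (simp add: borel_measurable_restrict_space_iff mult.commute)
  then have 2: "(\<lambda>t. f t * indicator {p<..<b} t) \<in> borel_measurable borel" by simp
  have "(\<lambda>t. f t * indicator {a<..<p} t + f t * indicator {p<..<b} t + f p * indicator ({p} \<inter> {a<..<b}) t)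
      \<in> borel_measurable borel"
    by (intro borel_measurable_add 1 2) auto
  also have "(\<lambda>t. f t * indicator {a<..<p} t + f t * indicator {p<..<b} t + f p * indicator ({p} \<inter> {a<..<b}) t)
     = (\<lambda>t. f t * indicator {a<..<b} t)"
    using assms(3,4) by (auto simp: fun_eq_iff indicator_def)
  finally show ?thesis .
qed

text \<open>The two densities need to agree almost everywhere only: at the mode \<open>F\<close> may
  be infinite, which no real \<open>f\<close> can match.\<close>

lemma circle_rep_add_angle_density:
  assumes [measurable]: "F \<in> borel_measurable circle_borel"
    and f: "(\<lambda>t. ennreal (f t)) \<in> borel_measurable (restrict_space lborel {a<..<a + 2 * pi})"
    and eq: "AE t in lborel. t \<in> {a<..<a + 2 * pi} \<longrightarrow> F (cis t) = ennreal (f t)"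
  shows "circle_rep (add_measure (scale_measure c (return circle_borel (cis \<phi>)))
           (angle_density {a<..<a + 2 * pi} f)) c (cis \<phi>) F"
  unfolding circle_rep_def
proof (intro conjI ballI)
  fix G :: "complex \<Rightarrow> ennreal" assume [measurable]: "G \<in> borel_measurable circle_borel"
  have "(\<integral>\<^sup>+z. G z \<partial>angle_density {a<..<a + 2 * pi} f) = (\<integral>\<^sup>+z. F z * G z \<partial>arc_measure)"
  proof (subst nn_integral_angle_density)
    have "(\<integral>\<^sup>+t. ennreal (f t) * G (cis t) * indicator {a<..<a + 2 * pi} t \<partial>lborel)
        = (\<integral>\<^sup>+t. F (cis t) * G (cis t) * indicator {a<..<a + 2 * pi} t \<partial>lborel)"
      using eq by (intro nn_integral_cong_AE) (auto elim!: eventually_mono split: split_indicator)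
    also have "\<dots> = (\<integral>\<^sup>+z. F z * G z \<partial>arc_measure)"
      by (subst nn_integral_arc_Ioo[of _ a]) simp_all
    finally show "(\<integral>\<^sup>+t. ennreal (f t) * G (cis t) * indicator {a<..<a + 2 * pi} t \<partial>lborel)
        = (\<integral>\<^sup>+z. F z * G z \<partial>arc_measure)" .
  qed (use f in simp_all)
  moreover have "G \<in> borel_measurable (scale_measure c (return circle_borel (cis \<phi>)))"
    by (subst measurable_cong_sets[of _ circle_borel borel borel]) simp_all
  ultimately show "(\<integral>\<^sup>+z. G z \<partial>add_measure (scale_measure c (return circle_borel (cis \<phi>)))
           (angle_density {a<..<a + 2 * pi} f)) = c * G (cis \<phi>) + (\<integral>\<^sup>+z. F z * G z \<partial>arc_measure)"
    by (subst nn_integral_add_measure)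
       (simp_all add: nn_integral_scale_measure nn_integral_return)
qed simp_all

text \<open>Quasiconvexity on the circle cut open at the mode: the density falls and then rises on
  the way round. The three-point form does not mention the antimode, and the value at the mode
  itself stays free.\<close>

definition v_shaped :: "real \<Rightarrow> (complex \<Rightarrow> ennreal) \<Rightarrow> bool" where
  "v_shaped \<phi> F \<longleftrightarrow> (\<forall>b c d. \<phi> < b \<longrightarrow> b < c \<longrightarrow> c < d \<longrightarrow> d < \<phi> + 2 * pi \<longrightarrow>
     F (cis c) \<le> max (F (cis b)) (F (cis d)))"

text \<open>The middle point is compared with its left neighbour if it comes before the antimode
  \<open>\<psi> + 2 * pi\<close>, where \<open>f\<close> decreases, and with its right neighbour,
  after subtracting a full turn, if it comes later.\<close>

lemma circle_unimodal_rep: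
  assumes "circle_unimodal \<mu>"
  obtains \<phi> c F where "circle_rep \<mu> c (cis \<phi>) F" "v_shaped \<phi> F"
proof -
  obtain \<phi> \<psi> c f where h: "0 \<le> \<phi> - \<psi>" "\<phi> - \<psi> \<le> 2 * pi" "0 \<le> c"
      "\<forall>\<theta> \<in> {\<psi><..<\<psi> + 2 * pi}. 0 \<le> f \<theta>"
      "mono_on {\<psi><..<\<phi>} f" "antimono_on {\<phi><..<\<psi> + 2 * pi} f"
      "\<mu> = add_measure (scale_measure (ennreal c) (return circle_borel (cis \<phi>)))
                         (angle_density {\<psi><..<\<psi> + 2 * pi} f)"
    using assms unfolding circle_unimodal_def by blast
  define g where "g t = f t * indicator {\<psi><..<\<psi> + 2 * pi} t" for t
  have g [measurable]: "g \<in> borel_measurable borel"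
    unfolding g_def using h by (intro borel_measurable_unimodal[of _ \<phi>]) auto
  \<comment> \<open>This makes \<open>F\<close> vanish at the antimode, where a \<open>v_shaped\<close> function may be small but not large.\<close>
  define F where "F z = ennreal (g (\<psi> + pi + Arg (z * cis (- \<psi> - pi))))" for z
  have Fcis: "F (cis t) = ennreal (g t)" if "\<psi> < t" "t \<le> \<psi> + 2 * pi" for t
    using that by (simp add: F_def cis_mult Arg_cis)
  have F2: "F (cis t) = F (cis (t - 2 * pi))" for t
    by (simp flip: cis_divide)
  have [measurable]: "F \<in> borel_measurable circle_borel"
    unfolding F_def by measurable
  have f: "(\<lambda>t. ennreal (f t)) \<in> borel_measurable (restrict_space lborel {\<psi><..<\<psi> + 2 * pi})"
  proof -
    have "(\<lambda>t. ennreal (g t)) \<in> borel_measurable (restrict_space lborel {\<psi><..<\<psi> + 2 * pi})"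
      by (intro measurable_restrict_space1) auto
    then show ?thesis
      by (rule measurable_cong[THEN iffD1, rotated]) (simp add: g_def space_restrict_space)
  qed
  have "circle_rep \<mu> (ennreal c) (cis \<phi>) F"
    unfolding h(7) using f by (intro circle_rep_add_angle_density) (auto simp: Fcis g_def)
  moreover have "v_shaped \<phi> F"
    unfolding v_shaped_def
  proof (intro allI impI)
    fix x y z assume xyz: "\<phi> < x" "x < y" "y < z" "z < \<phi> + 2 * pi"
    consider "y < \<psi> + 2 * pi" | "y = \<psi> + 2 * pi" | "y > \<psi> + 2 * pi" by linarith
    then show "F (cis y) \<le> max (F (cis x)) (F (cis z))"
    proof cases
      case 1
      then have "f y \<le> f x"
        using h(6) xyz by (auto simp: monotone_on_def)
      then have "F (cis y) \<le> F (cis x)"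
        using 1 xyz h by (simp add: Fcis g_def ennreal_leI)
      then show ?thesis by (simp add: le_max_iff_disj)
    next
      case 2
      then show ?thesis by (simp add: Fcis g_def)
    next
      case 3
      then have "f (y - 2 * pi) \<le> f (z - 2 * pi)"
        using h(5) xyz by (auto simp: monotone_on_def)
      then have "F (cis y) \<le> F (cis z)"
        using 3 xyz h by (simp add: F2[of y] F2[of z] Fcis g_def ennreal_leI)
      then show ?thesis by (simp add: le_max_iff_disj)
    qed
  qed
  ultimately show thesis by (rule that)
qed

section \<open>Convolution\<close>

lemma nn_integral_circle_conv:
  assumes [measurable_cong]: "sets \<mu> = sets circle_borel" "sets \<nu> = sets circle_borel"
    and "sigma_finite_measure \<nu>" and [measurable]: "G \<in> borel_measurable circle_borel"
  shows "(\<integral>\<^sup>+z. G z \<partial>(\<mu> \<circledast> \<nu>)) = (\<integral>\<^sup>+x. (\<integral>\<^sup>+y. G (x * y) \<partial>\<nu>) \<partial>\<mu>)"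
proof -
  interpret sigma_finite_measure \<nu> by fact
  have "(\<integral>\<^sup>+z. G z \<partial>(\<mu> \<circledast> \<nu>)) = (\<integral>\<^sup>+p. G (fst p * snd p) \<partial>(\<mu> \<Otimes>\<^sub>M \<nu>))"
    unfolding circle_conv_def by (subst nn_integral_distr) (auto simp: case_prod_beta')
  also have "\<dots> = (\<integral>\<^sup>+x. (\<integral>\<^sup>+y. G (x * y) \<partial>\<nu>) \<partial>\<mu>)"
    by (subst nn_integral_fst[symmetric]) auto
  finally show ?thesis .
qed

lemma sets_circle_conv [simp, measurable_cong]: "sets (\<mu> \<circledast> \<nu>) = sets circle_borel"
  by (simp add: circle_conv_def)

lemma cnj_mult_unit: "cmod z = 1 \<Longrightarrow> z * cnj z = 1" "cmod z = 1 \<Longrightarrow> cnj z * z = 1"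
  by (simp_all add: complex_norm_square[symmetric] mult.commute)

text \<open>Tonelli is applied twice, and in between rotation invariance of arc length gives the
  substitution z = x * y. Hence a density stays a density under convolution.\<close>

lemma nn_integral_arc_conv:
  assumes [measurable_cong]: "sets \<nu> = sets circle_borel" and \<nu>: "sigma_finite_measure \<nu>"
    and [measurable]: "F \<in> borel_measurable circle_borel" "G \<in> borel_measurable circle_borel"
  shows "(\<integral>\<^sup>+x. F x * (\<integral>\<^sup>+y. G (x * y) \<partial>\<nu>) \<partial>arc_measure)
      = (\<integral>\<^sup>+z. (\<integral>\<^sup>+y. F (z * cnj y) \<partial>\<nu>) * G z \<partial>arc_measure)"
proof -
  interpret N: sigma_finite_measure \<nu> by fact
  interpret L: finite_measure arc_measure by (rule finite_measure_arc)
  interpret pair_sigma_finite arc_measure \<nu> ..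
  have "space \<nu> = sphere 0 1" using sets_eq_imp_space_eq[OF assms(1)] by simp
  then have sub: "(\<integral>\<^sup>+x. F x * G (x * y) \<partial>arc_measure) = (\<integral>\<^sup>+z. F (z * cnj y) * G z \<partial>arc_measure)"
    if "y \<in> space \<nu>" for y
    using that nn_integral_arc_mult[of "\<lambda>z. F (z * cnj y) * G z" y]
    by (simp add: cnj_mult_unit mult.assoc[of y] mult.commute[of y])
       (simp add: mult.assoc cnj_mult_unit)
  have "(\<integral>\<^sup>+x. F x * (\<integral>\<^sup>+y. G (x * y) \<partial>\<nu>) \<partial>arc_measure)
      = (\<integral>\<^sup>+x. (\<integral>\<^sup>+y. F x * G (x * y) \<partial>\<nu>) \<partial>arc_measure)"
    by (intro nn_integral_cong nn_integral_cmult[symmetric]) simp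
  also have "\<dots> = (\<integral>\<^sup>+y. (\<integral>\<^sup>+x. F x * G (x * y) \<partial>arc_measure) \<partial>\<nu>)"
    by (rule Fubini'[symmetric]) simp
  also have "\<dots> = (\<integral>\<^sup>+y. (\<integral>\<^sup>+z. F (z * cnj y) * G z \<partial>arc_measure) \<partial>\<nu>)"
    by (intro nn_integral_cong sub)
  also have "\<dots> = (\<integral>\<^sup>+z. (\<integral>\<^sup>+y. F (z * cnj y) * G z \<partial>\<nu>) \<partial>arc_measure)"
    by (rule Fubini') simp
  also have "\<dots> = (\<integral>\<^sup>+z. (\<integral>\<^sup>+y. F (z * cnj y) \<partial>\<nu>) * G z \<partial>arc_measure)"
    by (intro nn_integral_cong nn_integral_multc) simp
  finally show ?thesis .
qed

text \<open>The second factor is an arbitrary probability measure, since the measure in (2) need not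
  consist of an atom and a density.\<close>

lemma circle_rep_conv_density:
  assumes \<mu>: "circle_rep \<mu> 0 s F" and \<nu>: "circle_prob \<nu>"
  shows "circle_rep (\<mu> \<circledast> \<nu>) 0 s (\<lambda>z. \<integral>\<^sup>+w. F (z * cnj w) \<partial>\<nu>)"
proof -
  have [measurable_cong]: "sets \<mu> = sets circle_borel" "sets \<nu> = sets circle_borel"
    and [measurable]: "F \<in> borel_measurable circle_borel" and s: "cmod s = 1"
    and "prob_space \<nu>"
    using assms by (auto simp: circle_rep_def circle_prob_def)
  interpret prob_space \<nu> by fact
  show ?thesis
    unfolding circle_rep_def
  proof (intro conjI ballI)
    fix G :: "complex \<Rightarrow> ennreal" assume [measurable]: "G \<in> borel_measurable circle_borel"
    show "(\<integral>\<^sup>+z. G z \<partial>(\<mu> \<circledast> \<nu>)) = 0 * G s + (\<integral>\<^sup>+z. (\<integral>\<^sup>+w. F (z * cnj w) \<partial>\<nu>) * G z \<partial>arc_measure)"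
      by (subst nn_integral_circle_conv)
         (simp_all add: sigma_finite_measure_axioms \<open>sets \<mu> = _\<close> \<open>sets \<nu> = _\<close> circle_rep_integral[OF \<mu>] nn_integral_arc_conv)
  qed (simp_all add: s)
qed

lemma circle_rep_conv:
  assumes \<mu>: "circle_rep \<mu> c s F" and \<nu>: "circle_rep \<nu> d s' F'" "sigma_finite_measure \<nu>"
  shows "circle_rep (\<mu> \<circledast> \<nu>) (c * d) (s * s')
    (\<lambda>z. c * F' (cnj s * z) + d * F (z * cnj s') + (\<integral>\<^sup>+w. F (z * cnj w) * F' w \<partial>arc_measure))"
proof -
  have S: "sets \<mu> = sets circle_borel" "sets \<nu> = sets circle_borel"
    and [measurable]: "F \<in> borel_measurable circle_borel" "F' \<in> borel_measurable circle_borel"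
    and s: "cmod s = 1" "cmod s' = 1"
    using assms by (auto simp: circle_rep_def)
  note S [measurable_cong]
  interpret sigma_finite_measure \<nu> by fact
  interpret L: finite_measure arc_measure by (rule finite_measure_arc)
  show ?thesis
    unfolding circle_rep_def
  proof (intro conjI ballI)
    fix G :: "complex \<Rightarrow> ennreal" assume [measurable]: "G \<in> borel_measurable circle_borel"
    have 1: "(\<integral>\<^sup>+y. F' y * G (s * y) \<partial>arc_measure) = (\<integral>\<^sup>+z. F' (cnj s * z) * G z \<partial>arc_measure)"
      using nn_integral_arc_mult[of "\<lambda>z. F' (cnj s * z) * G z" s] s
      by (simp add: mult.assoc[symmetric] cnj_mult_unit)
    have 2: "(\<integral>\<^sup>+y. F (z * cnj y) \<partial>\<nu>) = d * F (z * cnj s') + (\<integral>\<^sup>+w. F (z * cnj w) * F' w \<partial>arc_measure)"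
      if "cmod z = 1" for z
      using that by (subst circle_rep_integral[OF \<nu>(1)]) (auto simp: mult.commute)
    have "(\<integral>\<^sup>+z. G z \<partial>(\<mu> \<circledast> \<nu>)) = (\<integral>\<^sup>+x. (\<integral>\<^sup>+y. G (x * y) \<partial>\<nu>) \<partial>\<mu>)"
      using S \<nu> by (intro nn_integral_circle_conv) auto
    also have "\<dots> = c * (\<integral>\<^sup>+y. G (s * y) \<partial>\<nu>) + (\<integral>\<^sup>+x. F x * (\<integral>\<^sup>+y. G (x * y) \<partial>\<nu>) \<partial>arc_measure)"
      by (subst circle_rep_integral[OF \<mu>]) auto
    also have "(\<integral>\<^sup>+x. F x * (\<integral>\<^sup>+y. G (x * y) \<partial>\<nu>) \<partial>arc_measure)
        = (\<integral>\<^sup>+z. (\<integral>\<^sup>+y. F (z * cnj y) \<partial>\<nu>) * G z \<partial>arc_measure)"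
      using S \<nu> by (intro nn_integral_arc_conv) auto
    also have "\<dots> = (\<integral>\<^sup>+z. (d * F (z * cnj s') + (\<integral>\<^sup>+w. F (z * cnj w) * F' w \<partial>arc_measure)) * G z \<partial>arc_measure)"
      by (intro nn_integral_cong) (simp add: 2)
    also have "(\<integral>\<^sup>+y. G (s * y) \<partial>\<nu>) = d * G (s * s') + (\<integral>\<^sup>+z. F' (cnj s * z) * G z \<partial>arc_measure)"
      using s by (subst circle_rep_integral[OF \<nu>(1)]) (auto simp: 1)
    also have "c * (d * G (s * s') + (\<integral>\<^sup>+z. F' (cnj s * z) * G z \<partial>arc_measure))
        + (\<integral>\<^sup>+z. (d * F (z * cnj s') + (\<integral>\<^sup>+w. F (z * cnj w) * F' w \<partial>arc_measure)) * G z \<partial>arc_measure)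
      = c * d * G (s * s') + (\<integral>\<^sup>+z. (c * F' (cnj s * z) + d * F (z * cnj s')
          + (\<integral>\<^sup>+w. F (z * cnj w) * F' w \<partial>arc_measure)) * G z \<partial>arc_measure)"
      using s by (simp add: distrib_left distrib_right nn_integral_add nn_integral_cmult mult.assoc add.assoc)
    finally show "(\<integral>\<^sup>+z. G z \<partial>(\<mu> \<circledast> \<nu>)) = \<dots>" .
  qed (use s in \<open>simp_all add: norm_mult\<close>)
qed

section \<open>Measures invariant under conjugation\<close>

lemma circle_symmetric_nn_integral:
  assumes "circle_symmetric \<mu>" and S [measurable_cong]: "sets \<mu> = sets circle_borel"
    and [measurable]: "G \<in> borel_measurable circle_borel"
  shows "(\<integral>\<^sup>+z. G (cnj z) \<partial>\<mu>) = (\<integral>\<^sup>+z. G z \<partial>\<mu>)"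
proof -
  have sp: "space \<mu> = sphere 0 1" using sets_eq_imp_space_eq[OF S] by simp
  have "distr \<mu> circle_borel cnj = \<mu>"
  proof (rule measure_eqI)
    fix A assume "A \<in> sets (distr \<mu> circle_borel cnj)"
    then have A: "A \<in> sets circle_borel" by simp
    from sets.sets_into_space[OF this] have "cnj -` A \<inter> space \<mu> = cnj ` A"
      by (auto simp: sp image_iff intro!: bexI[of _ "cnj _"])
    then show "emeasure (distr \<mu> circle_borel cnj) A = emeasure \<mu> A"
      using A assms(1) by (subst emeasure_distr) (auto simp: circle_symmetric_def)
  qed (simp add: S)
  then have "(\<integral>\<^sup>+z. G z \<partial>\<mu>) = (\<integral>\<^sup>+z. G z \<partial>distr \<mu> circle_borel cnj)" by simp
  also have "\<dots> = (\<integral>\<^sup>+z. G (cnj z) \<partial>\<mu>)"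
    by (subst nn_integral_distr) auto
  finally show ?thesis by simp
qed

lemma circle_symmetric_conv:
  assumes "circle_prob \<mu>" "circle_prob \<nu>" and sym: "circle_symmetric \<mu>" "circle_symmetric \<nu>"
  shows "circle_symmetric (\<mu> \<circledast> \<nu>)"
  unfolding circle_symmetric_def
proof
  fix B assume B [measurable]: "B \<in> sets circle_borel"
  have S: "sets \<mu> = sets circle_borel" "sets \<nu> = sets circle_borel"
    using assms by (auto simp: circle_prob_def)
  note S [measurable_cong]
  interpret M: prob_space \<mu> using assms by (simp add: circle_prob_def)
  interpret N: prob_space \<nu> using assms by (simp add: circle_prob_def)
  have sN: "sigma_finite_measure \<nu>" by unfold_locales
  have cB: "cnj ` B = cnj -` B \<inter> space circle_borel"
    using sets.sets_into_space[OF B] by (auto simp: image_iff intro!: bexI[of _ "cnj _"])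
  have ind: "indicator (cnj ` B) z = (indicator B (cnj z) :: ennreal)" for z
    by (auto simp: indicator_def image_iff intro: bexI[of _ "cnj z"])
  have cB' [measurable]: "cnj ` B \<in> sets circle_borel"
    unfolding cB by measurable
  have "emeasure (\<mu> \<circledast> \<nu>) (cnj ` B) = (\<integral>\<^sup>+x. (\<integral>\<^sup>+y. indicator (cnj ` B) (x * y) \<partial>\<nu>) \<partial>\<mu>)"
    using nn_integral_circle_conv[OF S sN, of "indicator (cnj ` B)"] by simp
  also have "\<dots> = (\<integral>\<^sup>+x. (\<integral>\<^sup>+y. indicator B (cnj x * cnj y) \<partial>\<nu>) \<partial>\<mu>)"
    by (simp add: ind)
  also have "\<dots> = (\<integral>\<^sup>+x. (\<integral>\<^sup>+y. indicator B (cnj x * y) \<partial>\<nu>) \<partial>\<mu>)"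
    by (intro nn_integral_cong circle_symmetric_nn_integral sym S)
       (use sets_eq_imp_space_eq[OF S(1)] in simp)
  also have "\<dots> = (\<integral>\<^sup>+x. (\<integral>\<^sup>+y. indicator B (x * y) \<partial>\<nu>) \<partial>\<mu>)"
    by (rule circle_symmetric_nn_integral[OF sym(1) S(1)]) simp
  also have "\<dots> = emeasure (\<mu> \<circledast> \<nu>) B"
    using nn_integral_circle_conv[OF S sN, of "indicator B"] by simp
  finally show "emeasure (\<mu> \<circledast> \<nu>) B = emeasure (\<mu> \<circledast> \<nu>) (cnj ` B)" by simp
qed

text \<open>This second representation of the same measure is to be compared with the first:
  uniqueness then makes \<open>F\<close> symmetric almost everywhere and the position of a genuine
  atom real.\<close>

lemma circle_symmetric_rep:
  assumes "circle_symmetric \<mu>" and rep: "circle_rep \<mu> c s F"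
  shows "circle_rep \<mu> c (cnj s) (\<lambda>z. F (cnj z))"
proof -
  have S: "sets \<mu> = sets circle_borel" and [measurable]: "F \<in> borel_measurable circle_borel"
    and s: "cmod s = 1"
    using rep by (auto simp: circle_rep_def)
  show ?thesis
    unfolding circle_rep_def
  proof (intro conjI ballI)
    fix G :: "complex \<Rightarrow> ennreal" assume [measurable]: "G \<in> borel_measurable circle_borel"
    have "(\<integral>\<^sup>+z. G z \<partial>\<mu>) = (\<integral>\<^sup>+z. G (cnj z) \<partial>\<mu>)"
      using assms S by (intro circle_symmetric_nn_integral[symmetric]) auto
    also have "\<dots> = c * G (cnj s) + (\<integral>\<^sup>+z. F z * G (cnj z) \<partial>arc_measure)"
      by (subst circle_rep_integral[OF rep]) auto
    also have "(\<integral>\<^sup>+z. F z * G (cnj z) \<partial>arc_measure) = (\<integral>\<^sup>+z. F (cnj z) * G z \<partial>arc_measure)"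
      using nn_integral_arc_cnj[of "\<lambda>z. F (cnj z) * G z"] by simp
    finally show "(\<integral>\<^sup>+z. G z \<partial>\<mu>) = c * G (cnj s) + (\<integral>\<^sup>+z. F (cnj z) * G z \<partial>arc_measure)" .
  qed (use S s in simp_all)
qed

section \<open>Densities that increase with the real part\<close>

text \<open>On the unit circle this one condition contains both the invariance under conjugation
  (equal real parts) and the monotonicity from -1 to 1 along each half circle.\<close>

definition re_mono :: "(complex \<Rightarrow> ennreal) \<Rightarrow> bool" where
  "re_mono H \<longleftrightarrow> (\<forall>x y. cmod x = 1 \<longrightarrow> cmod y = 1 \<longrightarrow> Re x \<le> Re y \<longrightarrow> H x \<le> H y)"

lemma re_monoD: "re_mono H \<Longrightarrow> cmod x = 1 \<Longrightarrow> cmod y = 1 \<Longrightarrow> Re x \<le> Re y \<Longrightarrow> H x \<le> H y"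
  by (auto simp: re_mono_def)

lemma re_mono_cnj: "re_mono H \<Longrightarrow> cmod x = 1 \<Longrightarrow> H (cnj x) = H x"
  by (intro antisym) (auto intro!: re_monoD)

text \<open>An infinite value at \<open>t\<close> would spread to all angles from 0 to
  \<open>t\<close>, an interval of positive length. Unimodality asks for a real density, so
  finiteness away from the mode has to be known.\<close>

lemma re_mono_finite:
  assumes H: "re_mono H" and [measurable]: "H \<in> borel_measurable circle_borel"
    and fin: "(\<integral>\<^sup>+z. H z \<partial>arc_measure) < \<top>" and t: "0 < t" "t \<le> pi"
  shows "H (cis t) < \<top>"
proof (rule ccontr)
  assume "\<not> H (cis t) < \<top>"
  then have top: "H (cis t) = \<top>" by (metis top.not_eq_extremum)
  have inf: "H (cis u) = \<top>" if "0 \<le> u" "u \<le> t" for u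
    using re_monoD[OF H, of "cis t" "cis u"] that t top
    by (auto simp: top_unique intro!: cos_monotone_0_pi_le)
  have "\<top> = (\<integral>\<^sup>+u. \<top> * indicator {0<..<t} u \<partial>lborel)"
    using t by (subst nn_integral_cmult_indicator) (auto simp: ennreal_top_mult)
  also have "\<dots> \<le> (\<integral>\<^sup>+u. H (cis u) * indicator {-pi..<pi} u \<partial>lborel)"
    using t by (intro nn_integral_mono) (auto simp: inf split: split_indicator)
  also have "\<dots> = (\<integral>\<^sup>+z. H z \<partial>arc_measure)"
    by (subst nn_integral_arc) auto
  finally show False using fin by simp
qed

text \<open>The mode is at \<open>s\<close> and the antimode opposite to it. Finiteness of
  \<open>\<mu>\<close> makes the weight \<open>c\<close> and, off the mode, the density finite, so
  that \<open>enn2real\<close> loses nothing.\<close>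

lemma circle_unimodalI:
  assumes rep: "circle_rep \<mu> c s (\<lambda>z. H (cnj s * z))" and "finite_measure \<mu>"
    and H: "re_mono H" and [measurable]: "H \<in> borel_measurable circle_borel"
  shows "circle_unimodal \<mu>"
proof -
  interpret finite_measure \<mu> by fact
  have S: "sets \<mu> = sets circle_borel" and s: "cmod s = 1"
    and meas: "(\<lambda>z. H (cnj s * z)) \<in> borel_measurable circle_borel"
    using rep by (auto simp: circle_rep_def)
  obtain \<phi> where \<phi>: "s = cis \<phi>" using s by (rule circle_norm_cisE)
  have "emeasure \<mu> (space \<mu>) = (\<integral>\<^sup>+z. 1 \<partial>\<mu>)" by simp
  also have "\<dots> = c + (\<integral>\<^sup>+z. H (cnj s * z) \<partial>arc_measure)"
    by (subst circle_rep_integral[OF rep]) auto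
  also have "(\<integral>\<^sup>+z. H (cnj s * z) \<partial>arc_measure) = (\<integral>\<^sup>+z. H z \<partial>arc_measure)"
    using s by (intro nn_integral_arc_mult) auto
  finally have "c + (\<integral>\<^sup>+z. H z \<partial>arc_measure) < \<top>"
    using emeasure_finite[of "space \<mu>"] by (simp add: less_top)
  then have c: "c < \<top>" and fin: "(\<integral>\<^sup>+z. H z \<partial>arc_measure) < \<top>"
    by (simp_all add: less_top[symmetric])
  have Hfin: "H (cis t) < \<top>" if "0 < \<bar>t\<bar>" "\<bar>t\<bar> \<le> pi" for t
    using re_mono_finite[OF H _ fin, of "\<bar>t\<bar>"] that re_mono_cnj[OF H, of "cis t"]
    by (cases "t \<ge> 0") (auto simp: cis_cnj)
  define f where "f t = enn2real (H (cis (t - \<phi>)))" for t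
  have [measurable]: "f \<in> borel_measurable borel" unfolding f_def by measurable
  have cis: "cnj s * cis t = cis (t - \<phi>)" for t
    by (simp add: \<phi> cis_cnj cis_mult)
  have "circle_rep (add_measure (scale_measure c (return circle_borel (cis \<phi>)))
           (angle_density {\<phi> - pi<..<\<phi> - pi + 2 * pi} f)) c (cis \<phi>) (\<lambda>z. H (cnj s * z))"
  proof (rule circle_rep_add_angle_density[OF meas])
    show "(\<lambda>t. ennreal (f t)) \<in> borel_measurable (restrict_space lborel {\<phi> - pi<..<\<phi> - pi + 2 * pi})"
      by (intro measurable_restrict_space1) auto
    show "AE t in lborel. t \<in> {\<phi> - pi<..<\<phi> - pi + 2 * pi} \<longrightarrow> H (cnj s * cis t) = ennreal (f t)"
      using AE_lborel_singleton[of \<phi>]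
    proof eventually_elim
      case (elim t)
      then show ?case using Hfin[of "t - \<phi>"] by (auto simp: cis f_def)
    qed
  qed
  then have eq: "\<mu> = add_measure (scale_measure (ennreal (enn2real c)) (return circle_borel (cis \<phi>)))
           (angle_density {\<phi> - pi<..<\<phi> - pi + 2 * pi} f)"
    using circle_rep_measure_eqI[OF rep] c by (simp add: \<phi>)
  have "mono_on {\<phi> - pi<..<\<phi>} f"
  proof (rule mono_onI)
    fix x y assume xy: "x \<in> {\<phi> - pi<..<\<phi>}" "y \<in> {\<phi> - pi<..<\<phi>}" "x \<le> y"
    then have "cos (\<phi> - x) \<le> cos (\<phi> - y)" by (intro cos_monotone_0_pi_le) auto
    then have "cos (x - \<phi>) \<le> cos (y - \<phi>)" using cos_minus[of "x - \<phi>"] cos_minus[of "y - \<phi>"] by simp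
    then show "f x \<le> f y"
      unfolding f_def using xy by (intro enn2real_mono re_monoD[OF H] Hfin) auto
  qed
  moreover have "antimono_on {\<phi><..<\<phi> - pi + 2 * pi} f"
  proof (rule monotone_onI)
    fix x y assume xy: "x \<in> {\<phi><..<\<phi> - pi + 2 * pi}" "y \<in> {\<phi><..<\<phi> - pi + 2 * pi}" "x \<le> y"
    then have "cos (y - \<phi>) \<le> cos (x - \<phi>)" by (intro cos_monotone_0_pi_le) auto
    then show "f y \<le> f x"
      unfolding f_def using xy by (intro enn2real_mono re_monoD[OF H] Hfin) auto
  qed
  ultimately show ?thesis
    unfolding circle_unimodal_def
    by (intro exI[of _ \<phi>] exI[of _ "\<phi> - pi"] exI[of _ "enn2real c"] exI[of _ f] conjI eq)
       (auto simp: f_def)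
qed

text \<open>Without subtraction in \<open>ennreal\<close>, the gaps are written as summands; the two
  sides then differ by the product of the gaps.\<close>

lemma ennreal_rearrangement:
  fixes a b p q :: ennreal
  assumes "a \<le> b" "p \<le> q" shows "a * q + b * p \<le> b * q + a * p"
proof -
  obtain e f where "b = a + e" "q = p + f" using assms unfolding le_iff_add by blast
  then have "b * q + a * p = a * q + b * p + e * f" by (simp add: algebra_simps)
  then show ?thesis by simp
qed

text \<open>Both differences contain the factor \<open>sin ((a + b) / 2 - t)\<close>, and for 0 <= a
  <= b <= pi the other factors are nonnegative. This ties the order of the two \<open>F\<close>
  values to the order of the two \<open>G\<close> values in the rearrangement.\<close>

lemma cos_diff_reflect:
  fixes a b t :: real
  shows "cos (a - t) - cos (b - t) = 2 * sin ((a + b) / 2 - t) * sin ((b - a) / 2)"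
    and "cos t - cos (a + b - t) = 2 * sin ((a + b) / 2) * sin ((a + b) / 2 - t)"
proof -
  have "(a - t + (b - t)) / 2 = (a + b) / 2 - t" "(b - t - (a - t)) / 2 = (b - a) / 2"
    "(t + (a + b - t)) / 2 = (a + b) / 2" "(a + b - t - t) / 2 = (a + b) / 2 - t"
    by (simp_all add: field_simps)
  then show "cos (a - t) - cos (b - t) = 2 * sin ((a + b) / 2 - t) * sin ((b - a) / 2)"
    "cos t - cos (a + b - t) = 2 * sin ((a + b) / 2) * sin ((a + b) / 2 - t)"
    by (simp_all only: cos_diff_cos)
qed

lemma re_mono_conv:
  assumes F: "re_mono F" "F \<in> borel_measurable circle_borel"
    and G: "re_mono G" "G \<in> borel_measurable circle_borel"
  shows "re_mono (\<lambda>z. \<integral>\<^sup>+w. F (z * cnj w) * G w \<partial>arc_measure)"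
proof -
  note F(2) [measurable] G(2) [measurable]
  define h where "h z = (\<integral>\<^sup>+w. F (z * cnj w) * G w \<partial>arc_measure)" for z
  have h_cnj: "h (cnj z) = h z" if "cmod z = 1" for z
  proof -
    have "h (cnj z) = (\<integral>\<^sup>+w. F (cnj z * cnj (cnj w)) * G (cnj w) \<partial>arc_measure)"
      unfolding h_def using that by (intro nn_integral_arc_cnj[symmetric]) simp
    also have "\<dots> = h z"
      unfolding h_def
      by (intro nn_integral_cong)
         (use that re_mono_cnj[OF F(1), of "z * cnj _"] re_mono_cnj[OF G(1)] in \<open>auto simp: norm_mult\<close>)
    finally show ?thesis .
  qed
  have main: "h (cis b) \<le> h (cis a)" if ab: "0 \<le> a" "a \<le> b" "b \<le> pi" for a b
  proof -
    let ?x = "cis b" and ?y = "cis a"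
    \<comment> \<open>Under the reflection, \<open>u * cnj w\<close> becomes the conjugate of
      \<open>v * cnj w\<close>, and \<open>F\<close> takes the same value at conjugate
      points.\<close>
    have h_reflect: "h u = (\<integral>\<^sup>+w. F (v * cnj w) * G (u * v * cnj w) \<partial>arc_measure)"
      if u: "cmod u = 1" and v: "cmod v = 1" for u v
    proof -
      have "h u = (\<integral>\<^sup>+w. F (u * cnj (u * v * cnj w)) * G (u * v * cnj w) \<partial>arc_measure)"
        unfolding h_def using u v by (intro nn_integral_arc_reflect[symmetric]) (auto simp: norm_mult)
      also have "\<dots> = (\<integral>\<^sup>+w. F (v * cnj w) * G (u * v * cnj w) \<partial>arc_measure)"
      proof (intro nn_integral_cong arg_cong2[where f = times] refl)
        fix w assume "w \<in> space arc_measure"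
        then have "cmod (v * cnj w) = 1" using v by (simp add: norm_mult)
        from re_mono_cnj[OF F(1) this] show "F (u * cnj (u * v * cnj w)) = F (v * cnj w)"
          using u by (simp add: mult.assoc[symmetric] cnj_mult_unit)
      qed
      finally show ?thesis .
    qed
    let ?I = "\<lambda>u v. \<integral>\<^sup>+w. F (u * cnj w) * G w + F (v * cnj w) * G (?x * ?y * cnj w) \<partial>arc_measure"
    have split: "?I u v = h u + (\<integral>\<^sup>+w. F (v * cnj w) * G (?x * ?y * cnj w) \<partial>arc_measure)"
      if "cmod u = 1" "cmod v = 1" for u v
      unfolding h_def using that by (intro nn_integral_add) simp_all
    \<comment> \<open>One copy of \<open>h\<close> is kept and the other is reflected. Only this sum
      can be compared pointwise; the factor 2 is cancelled at the end.\<close>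
    have "2 * h ?x = h ?x + h ?x" by (rule mult_2)
    also have "\<dots> = ?I ?x ?y"
      using split[of ?x ?y] h_reflect[of ?x ?y] by simp
    also have "\<dots> \<le> (\<integral>\<^sup>+w. F (?y * cnj w) * G w + F (?x * cnj w) * G (?x * ?y * cnj w) \<partial>arc_measure)"
    proof (intro nn_integral_mono)
      fix w assume "w \<in> space arc_measure"
      then obtain t where w: "w = cis t" by (auto elim: circle_norm_cisE)
      have sm: "sin ((a + b) / 2) \<ge> 0" and sd: "sin ((b - a) / 2) \<ge> 0"
        using ab by (auto intro!: sin_ge_zero)
      let ?v = "?x * ?y * cnj w"
      have v: "?v = cis (a + b - t)" by (simp add: w cis_cnj cis_mult algebra_simps)
      have x: "?x * cnj w = cis (b - t)" and y: "?y * cnj w = cis (a - t)"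
        by (simp_all add: w cis_cnj cis_mult)
      consider "cos (a + b - t) = cos t" | "cos (a + b - t) < cos t" | "cos (a + b - t) > cos t" by linarith
      then show "F (?x * cnj w) * G w + F (?y * cnj w) * G ?v \<le> F (?y * cnj w) * G w + F (?x * cnj w) * G ?v"
        unfolding x y v unfolding w
      proof cases
        \<comment> \<open>Here \<open>sin ((a + b) / 2)\<close> may vanish and the order of the
          \<open>F\<close> values remain unknown, but equal \<open>G\<close> values make both sides
          equal.\<close>
        case 1
        then have "G (cis (a + b - t)) = G (cis t)"
          by (intro antisym re_monoD[OF G(1)]) auto
        then show "F (cis (b - t)) * G (cis t) + F (cis (a - t)) * G (cis (a + b - t))
            \<le> F (cis (a - t)) * G (cis t) + F (cis (b - t)) * G (cis (a + b - t))"
          by (simp add: add.commute)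
      next
        case 2
        then have "0 < 2 * sin ((a + b) / 2) * sin ((a + b) / 2 - t)"
          unfolding cos_diff_reflect(2)[symmetric] by simp
        then have "sin ((a + b) / 2 - t) \<ge> 0"
          using sm by (auto simp: zero_less_mult_iff)
        then have "0 \<le> 2 * sin ((a + b) / 2 - t) * sin ((b - a) / 2)"
          using sd by simp
        then have "cos (b - t) \<le> cos (a - t)"
          unfolding cos_diff_reflect(1)[symmetric] by simp
        with 2 show "F (cis (b - t)) * G (cis t) + F (cis (a - t)) * G (cis (a + b - t))
            \<le> F (cis (a - t)) * G (cis t) + F (cis (b - t)) * G (cis (a + b - t))"
          by (intro ennreal_rearrangement re_monoD[OF F(1)] re_monoD[OF G(1)]) auto
      next
        case 3
        then have "2 * sin ((a + b) / 2) * sin ((a + b) / 2 - t) < 0"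
          unfolding cos_diff_reflect(2)[symmetric] by simp
        then have "sin ((a + b) / 2 - t) \<le> 0"
          using sm by (auto simp: mult_less_0_iff)
        then have "2 * sin ((a + b) / 2 - t) * sin ((b - a) / 2) \<le> 0"
          using sd mult_nonpos_nonneg[of "2 * sin ((a + b) / 2 - t)" "sin ((b - a) / 2)"] by simp
        then have "cos (a - t) \<le> cos (b - t)"
          unfolding cos_diff_reflect(1)[symmetric] by simp
        with 3 have "F (cis (a - t)) * G (cis (a + b - t)) + F (cis (b - t)) * G (cis t)
            \<le> F (cis (b - t)) * G (cis (a + b - t)) + F (cis (a - t)) * G (cis t)"
          by (intro ennreal_rearrangement re_monoD[OF F(1)] re_monoD[OF G(1)]) auto
        then show "F (cis (b - t)) * G (cis t) + F (cis (a - t)) * G (cis (a + b - t))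
            \<le> F (cis (a - t)) * G (cis t) + F (cis (b - t)) * G (cis (a + b - t))"
          by (simp add: add.commute)
      qed
    qed
    also have "\<dots> = h ?y + h ?y"
      using split[of ?y ?x] h_reflect[of ?y ?x] by (simp add: mult.commute[of ?y ?x])
    also have "\<dots> = 2 * h ?y" by (rule mult_2[symmetric])
    finally show ?thesis by (simp add: ennreal_mult_le_mult_iff)
  qed
  have "h x \<le> h y" if xy: "cmod x = 1" "cmod y = 1" "Re x \<le> Re y" for x y
  proof -
    have *: "\<exists>a. 0 \<le> a \<and> a \<le> pi \<and> h z = h (cis a) \<and> cos a = Re z" if z: "cmod z = 1" for z
    proof -
      obtain a where a: "z = cis a" "-pi < a" "a \<le> pi" using z by (rule circle_norm_cisE)
      then show ?thesis using h_cnj[OF z]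
        by (cases "a \<ge> 0") (auto simp: cis_cnj intro: exI[of _ a] exI[of _ "-a"])
    qed
    from *[OF xy(1)] *[OF xy(2)] obtain b a where ab:
      "0 \<le> b" "b \<le> pi" "h x = h (cis b)" "cos b = Re x"
      "0 \<le> a" "a \<le> pi" "h y = h (cis a)" "cos a = Re y" by blast
    then have "a \<le> b" using xy(3) cos_mono_le_eq[of b a] by simp
    with ab main show ?thesis by simp
  qed
  then show ?thesis by (simp add: re_mono_def h_def)
qed

section \<open>Symmetric unimodal measures\<close>

lemma v_shaped_shift: 
  assumes "v_shaped \<phi> F" shows "v_shaped (\<phi> + 2 * pi * of_int k) F"
  unfolding v_shaped_def
proof (intro allI impI)
  fix b c d assume "\<phi> + 2 * pi * of_int k < b" "b < c" "c < d" "d < \<phi> + 2 * pi * of_int k + 2 * pi"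
  then have "F (cis (c - 2 * pi * of_int k)) \<le> max (F (cis (b - 2 * pi * of_int k))) (F (cis (d - 2 * pi * of_int k)))"
    using assms unfolding v_shaped_def by (intro assms[unfolded v_shaped_def, rule_format]) auto
  moreover have "cis (t - 2 * pi * of_int k) = cis t" for t
    using cis_add_2pi_int(1)[of "t - 2 * pi * of_int k" k] by simp
  ultimately show "F (cis c) \<le> max (F (cis b)) (F (cis d))" by simp
qed

lemma real_window_cover:
  fixes a \<phi> :: real
  obtains k :: int where "\<phi> + 2 * pi * of_int k \<le> a" "a < \<phi> + 2 * pi * of_int k + 2 * pi"
proof
  define q where "q = (a - \<phi>) / (2 * pi)"
  have a: "a = \<phi> + 2 * pi * q" by (simp add: q_def)
  have "2 * pi * of_int \<lfloor>q\<rfloor> \<le> 2 * pi * q" "2 * pi * q < 2 * pi * (of_int \<lfloor>q\<rfloor> + 1)"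
    by (intro mult_left_mono mult_strict_left_mono; linarith | simp)+
  then show "\<phi> + 2 * pi * of_int \<lfloor>q\<rfloor> \<le> a" "a < \<phi> + 2 * pi * of_int \<lfloor>q\<rfloor> + 2 * pi"
    by (simp_all add: a algebra_simps)
qed

lemma cis_add_2pi [simp]: "cis (t + 2 * pi) = cis t"
  using cis_add_2pi_int(1)[of t 1] by simp

text \<open>Cut at the mode, the circle becomes an interval in which \<open>a\<close> or
  \<open>c\<close> lies between \<open>b\<close> and \<open>d\<close>, so its value is at most the
  larger of theirs. The cases say in which of the four gaps the cut falls. The points must avoid the
  mode, where nothing is known about \<open>F\<close>.\<close>

lemma v_shaped_four_points:
  assumes v: "v_shaped \<phi> F" and ord: "a < b" "b < c" "c < d" "d < a + 2 * pi"
    and ne: "cis a \<noteq> cis \<phi>" "cis b \<noteq> cis \<phi>" "cis c \<noteq> cis \<phi>" "cis d \<noteq> cis \<phi>"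
  shows "min (F (cis a)) (F (cis c)) \<le> max (F (cis b)) (F (cis d))"
proof -
  obtain k where k: "\<phi> + 2 * pi * of_int k \<le> a" "a < \<phi> + 2 * pi * of_int k + 2 * pi"
    by (rule real_window_cover)
  define p where "p = \<phi> + 2 * pi * of_int k"
  have p: "cis p = cis \<phi>" by (simp add: p_def)
  have q: "cis (p + 2 * pi) = cis \<phi>" by (simp add: p)
  have vp: "v_shaped p F" and vq: "v_shaped (p + 2 * pi) F"
    using v_shaped_shift[OF v, of k] v_shaped_shift[OF v, of "k + 1"] by (simp_all add: p_def algebra_simps)
  have "p < a" using k ne(1) p by (cases "p = a") (auto simp: p_def)
  have neq: "p + 2 * pi \<noteq> b" "p + 2 * pi \<noteq> c" "p + 2 * pi \<noteq> d" using ne q by auto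
  have P: "F (cis y) \<le> max (F (cis x)) (F (cis z))" if "p < x" "x < y" "y < z" "z < p + 2 * pi" for x y z
    using vp that by (auto simp: v_shaped_def)
  have Q: "F (cis y) \<le> max (F (cis x)) (F (cis z))"
    if "p + 2 * pi < x" "x < y" "y < z" "z < p + 4 * pi" for x y z
    using vq that by (auto simp: v_shaped_def)
  have "a < p + 2 * pi" using k by (simp add: p_def)
  consider "p + 2 * pi < b" | "b < p + 2 * pi" "p + 2 * pi < c" | "c < p + 2 * pi" "p + 2 * pi < d" | "d < p + 2 * pi"
    using neq by linarith
  then show ?thesis
  proof cases
    case 1
    then have "F (cis c) \<le> max (F (cis b)) (F (cis d))"
      using ord \<open>a < p + 2 * pi\<close> by (intro Q) auto
    then show ?thesis by (rule min.coboundedI2)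
  next
    case 2
    then have "F (cis (a + 2 * pi)) \<le> max (F (cis d)) (F (cis (b + 2 * pi)))"
      using ord by (intro Q) auto
    then show ?thesis by (intro min.coboundedI1) (simp add: max.commute)
  next
    case 3
    then have "F (cis (a + 2 * pi)) \<le> max (F (cis d)) (F (cis (b + 2 * pi)))"
      using ord by (intro Q) auto
    then show ?thesis by (intro min.coboundedI1) (simp add: max.commute)
  next
    case 4
    then have "F (cis c) \<le> max (F (cis b)) (F (cis d))"
      using ord \<open>p < a\<close> by (intro P) auto
    then show ?thesis by (rule min.coboundedI2)
  qed
qed

text \<open>\<open>S\<close> is any set of reals, as only almost all angles are under control. One
  strict descent from \<open>x\<close> to \<open>y\<close> forces values at least \<open>g x\<close>
  to the left of \<open>x\<close>, at most \<open>g y\<close> to the right of \<open>y\<close>, and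
  values in between on the middle part; no position is left for a strict ascent.\<close>

lemma monotone_on_of_betweenness:
  fixes g :: "real \<Rightarrow> 'b::linorder"
  assumes btw: "\<And>x y z. x \<in> S \<Longrightarrow> y \<in> S \<Longrightarrow> z \<in> S \<Longrightarrow> x < y \<Longrightarrow> y < z \<Longrightarrow>
      min (g x) (g z) \<le> g y \<and> g y \<le> max (g x) (g z)"
  shows "mono_on S g \<or> antimono_on S g"
proof (rule ccontr)
  assume "\<not> ?thesis"
  then obtain x y u v where
    xy: "x \<in> S" "y \<in> S" "x \<le> y" "g y < g x" and uv: "u \<in> S" "v \<in> S" "u \<le> v" "g u < g v"
    by (auto simp: monotone_on_def not_le)
  then have lt: "x < y" "u < v" by (auto simp: order.strict_iff_order)
  have B: "g q \<le> g p \<or> g q \<le> g r" "g p \<le> g q \<or> g r \<le> g q"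
    if "p \<in> S" "q \<in> S" "r \<in> S" "p < q" "q < r" for p q r
    using btw[OF that] by (auto simp: le_max_iff_disj min_le_iff_disj)
  have above: "g z \<le> g y" if "z \<in> S" "y \<le> z" for z
    using B[of x y z] xy lt that by (cases "y = z") auto
  have below: "g x \<le> g z" if "z \<in> S" "z \<le> x" for z
    using B[of z x y] xy lt that by (cases "z = x") auto
  have mid: "g y \<le> g z" "g z \<le> g x" if "z \<in> S" "x < z" "z < y" for z
    using B[of x z y] xy that by auto
  consider "v \<le> x" | "u \<le> x" "x < v" | "x < u" "u < y" "v < y" | "x < u" "u < y" "y \<le> v" | "y \<le> u"
    by linarith
  then show False
  proof cases
    case 1
    then show False using B[of u v y] below[of v] xy uv lt by auto
  next
    case 2
    then have "g v \<le> g x" using mid[of v] above[of v] xy uv by (cases "v < y") auto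
    then show False using below[of u] 2 uv by auto
  next
    case 3
    then show False using B[of x u v] mid[of u] mid[of v] xy uv lt by auto
  next
    case 4
    then show False using mid[of u] above[of v] uv by auto
  next
    case 5
    then show False using B[of x u v] above[of u] xy uv lt by auto
  qed
qed

text \<open>The indicator of a superlevel set is a monotone real function, which reduces the claim
  to real values. It is applied to a function with values in \<open>ennreal\<close>.\<close>

lemma borel_measurable_mono_linorder:
  fixes f :: "real \<Rightarrow> 'b::{linorder_topology, second_countable_topology}"
  assumes "mono f" shows "f \<in> borel_measurable borel"
proof (rule borel_measurableI_greater)
  fix y
  have "mono (\<lambda>x. indicator {x. y < f x} x :: real)"
    using assms by (auto simp: mono_def indicator_def intro: less_le_trans)
  from borel_measurable_mono[OF this] show "{x \<in> space borel. y < f x} \<in> sets borel"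
    by (simp add: borel_measurable_indicator_iff)
qed

text \<open>
  Four-point comparisons for \<open>x < y < z\<close> in the upper half circle and their conjugates show that
  the density there lies between its values at the end points, so it is monotone off a null set.
\<close>

lemma circle_symmetric_unimodal_rep:
  assumes \<mu>: "circle_symmetric \<mu>" "circle_unimodal \<mu>"
  obtains s c H where "s \<in> {1, -1}" "circle_rep \<mu> c (of_real s) (\<lambda>z. H (of_real s * z))"
    "re_mono H" "H \<in> borel_measurable circle_borel"
proof -
  obtain \<phi> c F where rep: "circle_rep \<mu> c (cis \<phi>) F" and v: "v_shaped \<phi> F"
    using \<mu>(2) by (rule circle_unimodal_rep)
  have [measurable]: "F \<in> borel_measurable circle_borel"
    and S: "sets \<mu> = sets circle_borel" using rep by (auto simp: circle_rep_def)
  note rep' = circle_symmetric_rep[OF \<mu>(1) rep]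
  define good where "good z \<longleftrightarrow> F z = F (cnj z) \<and> z \<noteq> cis \<phi> \<and> cnj z \<noteq> cis \<phi> \<and> z \<noteq> 1 \<and> z \<noteq> -1" for z
  have "AE z in arc_measure. z \<noteq> cis \<phi>" "AE z in arc_measure. z \<noteq> cnj (cis \<phi>)"
    "AE z in arc_measure. z \<noteq> 1" "AE z in arc_measure. z \<noteq> -1"
    by (rule AE_arc_neq; simp)+
  with circle_rep_unique_AE[OF rep rep'] have "AE z in arc_measure. good z"
  proof eventually_elim
    case (elim z)
    then show ?case by (metis good_def complex_cnj_cnj)
  qed
  define S where "S = {t. 0 < t \<and> t < pi \<and> good (cis t)}"
  define g where "g t = F (cis t)" for t
  have S: "0 < t" "t < pi" "cis t \<noteq> cis \<phi>" "cis (2 * pi - t) \<noteq> cis \<phi>" "F (cis (2 * pi - t)) = g t" "F (cis (-t)) = g t"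
    "cis (2 * pi + t) \<noteq> cis \<phi>" "F (cis (2 * pi + t)) = g t"
    if "t \<in> S" for t
    using that cis_add_2pi[of "-t"] cis_add_2pi[of t] by (auto simp: S_def good_def g_def cis_cnj add.commute)
  have "mono_on S g \<or> antimono_on S g"
  proof (rule monotone_on_of_betweenness)
    fix x y z assume xyz: "x \<in> S" "y \<in> S" "z \<in> S" "x < y" "y < z"
    have "min (F (cis x)) (F (cis z)) \<le> max (F (cis y)) (F (cis (2 * pi - y)))"
      using xyz S[OF xyz(1)] S[OF xyz(2)] S[OF xyz(3)] by (intro v_shaped_four_points[OF v]) auto
    moreover have "min (F (cis y)) (F (cis (2 * pi - y))) \<le> max (F (cis z)) (F (cis (2 * pi + x)))"
      using xyz S[OF xyz(1)] S[OF xyz(2)] S[OF xyz(3)] by (intro v_shaped_four_points[OF v]) auto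
    ultimately show "min (g x) (g z) \<le> g y \<and> g y \<le> max (g x) (g z)"
      using S[OF xyz(1)] S[OF xyz(2)] by (simp add: g_def max.commute)
  qed
  \<comment> \<open>If there is an atom, \<open>s\<close> must be its position, so the direction of
    monotonicity has to match it. Uniqueness of the atom under conjugation makes the position
    real.\<close>
  moreover have "(cis \<phi> = 1 \<and> antimono_on S g) \<or> (cis \<phi> = -1 \<and> mono_on S g)" if "c \<noteq> 0"
  proof -
    have "cis \<phi> = cnj (cis \<phi>)" by (rule circle_rep_unique_atom[OF rep rep' that])
    then have "sin \<phi> = 0" by (simp add: complex_eq_iff)
    then obtain i :: int where i: "\<phi> = of_int i * pi" by (auto simp: sin_zero_iff_int2)
    show ?thesis
    proof (cases "even i")
      case True
      then obtain k where "i = 2 * k" by (elim evenE)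
      then have \<phi>: "\<phi> = 0 + 2 * pi * of_int k" by (simp add: i)
      have v0: "v_shaped 0 F" using v_shaped_shift[OF v, of "-k"] by (simp add: \<phi>)
      have "g y \<le> g x" if "x \<in> S" "y \<in> S" "x \<le> y" for x y
      proof (cases "x = y")
        case False
        then have "F (cis y) \<le> max (F (cis x)) (F (cis (2 * pi - x)))"
          using that S[of x] S[of y] by (intro v0[unfolded v_shaped_def, rule_format]) auto
        then show ?thesis using S[OF that(1)] by (simp add: g_def)
      qed simp
      moreover have "cis \<phi> = 1" unfolding \<phi> by simp
      ultimately show ?thesis by (auto simp: monotone_on_def)
    next
      case False
      then obtain k where "i = 2 * k + 1" by (elim oddE)
      then have \<phi>: "\<phi> = pi + 2 * pi * of_int k" by (simp add: i algebra_simps)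
      \<comment> \<open>The extra turn makes the window (-pi, pi), in which
        \<open>-y < x < y\<close>.\<close>
      have v0: "v_shaped (-pi) F" using v_shaped_shift[OF v, of "-k-1"] by (simp add: \<phi> algebra_simps)
      have "g x \<le> g y" if "x \<in> S" "y \<in> S" "x \<le> y" for x y
      proof (cases "x = y")
        case False
        then have "F (cis x) \<le> max (F (cis (-y))) (F (cis y))"
          using that S[of x] S[of y] by (intro v0[unfolded v_shaped_def, rule_format]) auto
        then show ?thesis using S[OF that(2)] by (simp add: g_def)
      qed simp
      moreover have "cis \<phi> = -1" unfolding \<phi> by simp
      ultimately show ?thesis by (auto simp: monotone_on_def)
    qed
  qed
  ultimately obtain s :: real where s: "s \<in> {1, -1}" "c \<noteq> 0 \<Longrightarrow> cis \<phi> = of_real s"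
    "\<And>x y. x \<in> S \<Longrightarrow> y \<in> S \<Longrightarrow> s * cos x \<le> s * cos y \<Longrightarrow> g x \<le> g y"
  proof (cases "(c \<noteq> 0 \<longrightarrow> cis \<phi> = 1) \<and> antimono_on S g")
    case True
    show thesis
    proof (rule that[of 1])
      fix x y assume "x \<in> S" "y \<in> S" "1 * cos x \<le> 1 * cos y"
      then show "g x \<le> g y"
        using True S[of x] S[of y] cos_mono_le_eq[of x y] by (auto simp: monotone_on_def)
    qed (use True in auto)
  next
    case False
    assume "mono_on S g \<or> antimono_on S g"
      and "c \<noteq> 0 \<Longrightarrow> (cis \<phi> = 1 \<and> antimono_on S g) \<or> (cis \<phi> = -1 \<and> mono_on S g)"
    with False have *: "c \<noteq> 0 \<longrightarrow> cis \<phi> = -1" "mono_on S g" by auto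
    show thesis
    proof (rule that[of "-1"])
      fix x y assume "x \<in> S" "y \<in> S" "-1 * cos x \<le> -1 * cos y"
      then show "g x \<le> g y"
        using * S[of x] S[of y] cos_mono_le_eq[of y x] by (auto simp: monotone_on_def)
    qed (use * in auto)
  qed
  \<comment> \<open>\<open>re_mono\<close> makes demands at every point, while \<open>g\<close> is
    controlled on \<open>S\<close> only; the supremum extends it monotonically to the whole
    line.\<close>
  define \<Phi> where "\<Phi> u = (SUP t\<in>{t\<in>S. s * cos t \<le> u}. g t)" for u
  define H where "H z = \<Phi> (Re z)" for z
  have mono: "mono \<Phi>" unfolding \<Phi>_def by (intro monoI SUP_subset_mono) auto
  have "H \<in> borel_measurable borel"
    unfolding H_def using borel_measurable_mono_linorder[OF mono] by measurable
  then have Hm [measurable]: "H \<in> borel_measurable circle_borel" by (rule borel_measurable_circleI)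
  have Hr: "re_mono H" using mono by (auto simp: re_mono_def H_def mono_def)
  have \<Phi>g: "\<Phi> (s * cos t) = g t" if "t \<in> S" for t
    unfolding \<Phi>_def using that s(3) by (intro antisym SUP_least SUP_upper) auto
  have "AE z in arc_measure. F z = H (of_real s * z)"
    using \<open>AE z in arc_measure. good z\<close> AE_space
  proof eventually_elim
    case (elim z)
    then obtain t where t: "z = cis t" "-pi < t" "t \<le> pi" by (auto elim: circle_norm_cisE)
    have "t \<noteq> 0" "t \<noteq> pi" using elim t by (auto simp: good_def)
    have "\<bar>t\<bar> \<in> S" using elim t \<open>t \<noteq> 0\<close> \<open>t \<noteq> pi\<close>
      by (cases "t \<ge> 0") (auto simp: S_def good_def cis_cnj[symmetric] complex_eq_iff)
    then have "\<Phi> (s * cos \<bar>t\<bar>) = g \<bar>t\<bar>" by (rule \<Phi>g)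
    moreover have "g \<bar>t\<bar> = F z"
      using elim t by (cases "t \<ge> 0") (auto simp: g_def good_def cis_cnj[symmetric])
    ultimately show ?case by (simp add: H_def t)
  qed
  then have "circle_rep \<mu> c (of_real s) (\<lambda>z. H (of_real s * z))"
  proof (rule circle_rep_cong[OF rep])
    show "cmod (of_real s) = 1" using s(1) by auto
    then show "(\<lambda>z. H (of_real s * z)) \<in> borel_measurable circle_borel" by measurable
  qed (rule s(2))
  with s(1) Hr Hm show thesis using that by blast
qed

lemma circle_prob_conv:
  assumes "circle_prob \<mu>" "circle_prob \<nu>" shows "circle_prob (\<mu> \<circledast> \<nu>)"
proof -
  have S: "sets \<mu> = sets circle_borel" "sets \<nu> = sets circle_borel"
    using assms by (auto simp: circle_prob_def)
  interpret M: prob_space \<mu> using assms by (simp add: circle_prob_def)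
  interpret N: prob_space \<nu> using assms by (simp add: circle_prob_def)
  have sN: "sigma_finite_measure \<nu>" by unfold_locales
  have "emeasure (\<mu> \<circledast> \<nu>) (space (\<mu> \<circledast> \<nu>)) = (\<integral>\<^sup>+z. 1 \<partial>(\<mu> \<circledast> \<nu>))" by simp
  also have "\<dots> = 1"
    using nn_integral_circle_conv[OF S sN, of "\<lambda>_. 1"] by (simp add: M.emeasure_space_1 N.emeasure_space_1)
  finally show ?thesis by (auto simp: circle_prob_def intro: prob_spaceI)
qed

text \<open>Since the signs satisfy s * s = 1, all contributions to the density turn by the same
  factor s * s'. Undoing this rotation leaves \<open>K\<close>, a sum of functions that increase
  with the real part, and the atom sits at s * s' as well.\<close>

lemma circle_unimodal_conv_symmetric:
  assumes "circle_prob \<mu>" "circle_symmetric \<mu>" "circle_unimodal \<mu>"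
    and "circle_prob \<nu>" "circle_symmetric \<nu>" "circle_unimodal \<nu>"
  shows "circle_unimodal (\<mu> \<circledast> \<nu>)"
proof -
  interpret N: prob_space \<nu> using assms by (simp add: circle_prob_def)
  obtain s :: real and c F where s: "s \<in> {1, -1}" and \<mu>: "circle_rep \<mu> c (of_real s) (\<lambda>z. F (of_real s * z))"
    and F: "re_mono F" "F \<in> borel_measurable circle_borel"
    using assms by (elim circle_symmetric_unimodal_rep)
  obtain s' :: real and d G where s': "s' \<in> {1, -1}" and \<nu>: "circle_rep \<nu> d (of_real s') (\<lambda>z. G (of_real s' * z))"
    and G: "re_mono G" "G \<in> borel_measurable circle_borel"
    using assms by (elim circle_symmetric_unimodal_rep)
  note F(2) [measurable] G(2) [measurable]
  define K where "K z = c * G z + d * F z + (\<integral>\<^sup>+w. F (z * cnj w) * G w \<partial>arc_measure)" for z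
  have norm: "cmod (of_real s) = 1" "cmod (of_real s') = 1" using s s' by auto
  interpret L: finite_measure arc_measure by (rule finite_measure_arc)
  have [measurable]: "K \<in> borel_measurable circle_borel" unfolding K_def by measurable
  have ss: "of_real s * of_real s = (1 :: complex)" "of_real s' * of_real s' = (1 :: complex)"
    using s s' by auto
  \<comment> \<open>The substitution of \<open>s' * w\<close> for \<open>w\<close> moves both signs
    in front of \<open>z\<close>.\<close>
  have int: "(\<integral>\<^sup>+w. F (of_real s * (z * cnj w)) * G (of_real s' * w) \<partial>arc_measure)
      = (\<integral>\<^sup>+w. F (cnj (of_real s * of_real s') * z * cnj w) * G w \<partial>arc_measure)" if z: "cmod z = 1" for z
  proof -
    have "F (of_real s * (z * cnj w)) = F (cnj (of_real s * of_real s') * z * cnj (of_real s' * w))" for w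
      using s s' by auto
    then show ?thesis
      using z norm by (simp only:) (rule nn_integral_arc_mult, simp_all add: norm_mult)
  qed
  have rep: "circle_rep (\<mu> \<circledast> \<nu>) (c * d) (of_real s * of_real s')
      (\<lambda>z. c * G (of_real s' * (cnj (of_real s) * z)) + d * F (of_real s * (z * cnj (of_real s')))
        + (\<integral>\<^sup>+w. F (of_real s * (z * cnj w)) * G (of_real s' * w) \<partial>arc_measure))"
    by (rule circle_rep_conv[OF \<mu> \<nu>]) unfold_locales
  have "circle_rep (\<mu> \<circledast> \<nu>) (c * d) (of_real s * of_real s') (\<lambda>z. K (cnj (of_real s * of_real s') * z))"
  proof (rule circle_rep_cong[OF rep])
    show "AE z in arc_measure. c * G (of_real s' * (cnj (of_real s) * z)) + d * F (of_real s * (z * cnj (of_real s')))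
        + (\<integral>\<^sup>+w. F (of_real s * (z * cnj w)) * G (of_real s' * w) \<partial>arc_measure)
        = K (cnj (of_real s * of_real s') * z)"
    proof (rule AE_I2)
      fix z assume "z \<in> space arc_measure"
      then have "cmod z = 1" by simp
      from int[OF this] show "c * G (of_real s' * (cnj (of_real s) * z)) + d * F (of_real s * (z * cnj (of_real s')))
        + (\<integral>\<^sup>+w. F (of_real s * (z * cnj w)) * G (of_real s' * w) \<partial>arc_measure)
        = K (cnj (of_real s * of_real s') * z)"
        unfolding K_def by (simp only: mult.assoc) (simp add: mult.left_commute mult.commute)
    qed
  qed (use norm in \<open>simp_all add: norm_mult\<close>)
  note rep = this
  have "re_mono K"
    unfolding re_mono_def K_def
    by (intro allI impI add_mono mult_left_mono re_monoD[OF F(1)] re_monoD[OF G(1)] re_monoD[OF re_mono_conv[OF F G]]) auto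
  then show ?thesis
    using circle_prob_conv[OF assms(1,4)]
    by (intro circle_unimodalI[OF rep]) (auto simp: circle_prob_def prob_space_def)
qed

section \<open>The Poisson kernel\<close>

lemma circle_rep_angle_density:
  assumes [measurable]: "h \<in> borel_measurable circle_borel"
  shows "circle_rep (angle_density {-pi..<pi} (\<lambda>t. h (cis t))) 0 1 (\<lambda>z. ennreal (h z))"
  unfolding circle_rep_def
proof (intro conjI ballI)
  fix G :: "complex \<Rightarrow> ennreal" assume [measurable]: "G \<in> borel_measurable circle_borel"
  have "(\<lambda>t. ennreal (h (cis t))) \<in> borel_measurable (restrict_space lborel {-pi..<pi})"
    by (intro measurable_restrict_space1) measurable
  then show "(\<integral>\<^sup>+z. G z \<partial>angle_density {-pi..<pi} (\<lambda>t. h (cis t)))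
      = 0 * G 1 + (\<integral>\<^sup>+z. ennreal (h z) * G z \<partial>arc_measure)"
    by (subst nn_integral_angle_density) (simp_all add: nn_integral_arc)
qed simp_all

definition poisson :: "real \<Rightarrow> complex \<Rightarrow> real" where
  "poisson r z = (1 - r\<^sup>2) / (2 * pi * (cmod (1 - complex_of_real r * z))\<^sup>2)"

lemma poisson_unit:
  assumes "cmod z = 1"
  shows "poisson r z = (1 - r\<^sup>2) / (2 * pi * (1 + r\<^sup>2 - 2 * r * Re z))"
proof -
  have "(Re z)\<^sup>2 + (Im z)\<^sup>2 = 1" using assms by (metis cmod_power2 one_power2)
  then have "(cmod (1 - complex_of_real r * z))\<^sup>2 = 1 + r\<^sup>2 - 2 * r * Re z"
    unfolding cmod_power2 by (simp add: power2_eq_square algebra_simps) algebra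
  then show ?thesis by (simp add: poisson_def)
qed

lemma poisson_denom_pos:
  fixes r c :: real
  assumes "0 < r" "r < 1" "\<bar>c\<bar> \<le> 1" shows "0 < 1 + r\<^sup>2 - 2 * r * c"
proof -
  have "0 < (1 - r)\<^sup>2" using assms by (intro zero_less_power) simp
  also have "\<dots> \<le> 1 + r\<^sup>2 - 2 * r * c"
    using assms mult_left_mono[of c 1 r] by (simp add: power2_eq_square algebra_simps)
  finally show ?thesis .
qed

lemma abs_Re_unit: "cmod z = 1 \<Longrightarrow> \<bar>Re z\<bar> \<le> 1"
  using abs_Re_le_cmod[of z] by simp

lemma poisson_nonneg: "0 < r \<Longrightarrow> r < 1 \<Longrightarrow> 0 \<le> poisson r z"
  unfolding poisson_def by (auto intro!: divide_nonneg_nonneg simp: power_le_one)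

lemma continuous_on_poisson:
  assumes "0 < r" "r < 1" shows "continuous_on (sphere 0 1) (poisson r)"
  unfolding poisson_def
proof (intro continuous_intros ballI)
  fix z :: complex assume "z \<in> sphere 0 1"
  then have "cmod (complex_of_real r * z) < cmod 1" using assms by (simp add: norm_mult)
  then have "1 - complex_of_real r * z \<noteq> 0" by auto
  then show "2 * pi * (cmod (1 - complex_of_real r * z))\<^sup>2 \<noteq> 0" by simp
qed

lemma poisson_measurable [measurable]: "poisson r \<in> borel_measurable borel"
  unfolding poisson_def by measurable

lemma poisson_kernel_rep:
  "circle_rep (poisson_kernel r \<psi>) 0 1 (\<lambda>z. ennreal (poisson r (cnj (cis \<psi>) * z)))"
  using circle_rep_angle_density[of "\<lambda>z. poisson r (cnj (cis \<psi>) * z)"]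
  by (simp add: poisson_kernel_def poisson_def cis_cnj cis_mult)

text \<open>There is no atom, so \<open>s\<close> is free. It serves as the centre of the density:
  \<open>cis \<psi>\<close> when unimodality is proved, 1 elsewhere.\<close>

lemma poisson_conv_rep:
  assumes "circle_prob \<nu>" and s: "cmod s = 1"
  shows "circle_rep (poisson_kernel r \<psi> \<circledast> \<nu>) 0 s
    (\<lambda>z. \<integral>\<^sup>+w. ennreal (poisson r (cnj (cis \<psi>) * z * cnj w)) \<partial>\<nu>)"
  using circle_rep_conv_density[OF poisson_kernel_rep assms(1), of r \<psi>] s
  by (auto simp: circle_rep_def mult.assoc)

text \<open>The total mass is that of the kernel, whose density is bounded by its value at angle
  0.\<close>

lemma finite_measure_poisson_conv:
  assumes r: "0 < r" "r < 1" and \<nu>: "circle_prob \<nu>"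
  shows "finite_measure (poisson_kernel r \<psi> \<circledast> \<nu>)"
proof
  have S: "sets (poisson_kernel r \<psi>) = sets circle_borel" "sets \<nu> = sets circle_borel"
    using \<nu> poisson_kernel_rep[of r \<psi>] by (auto simp: circle_prob_def circle_rep_def)
  interpret N: prob_space \<nu> using \<nu> by (simp add: circle_prob_def)
  have sN: "sigma_finite_measure \<nu>" by unfold_locales
  have bound: "poisson r z \<le> (1 - r\<^sup>2) / (2 * pi * (1 - r)\<^sup>2)" if "cmod z = 1" for z
    unfolding poisson_unit[OF that]
  proof (intro divide_left_mono mult_left_mono mult_pos_pos poisson_denom_pos r)
    show "(1 - r)\<^sup>2 \<le> 1 + r\<^sup>2 - 2 * r * Re z"
      using r abs_Re_unit[OF that] mult_left_mono[of "Re z" 1 r] by (simp add: power2_eq_square algebra_simps)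
    show "0 < (1 - r)\<^sup>2" using r by (intro zero_less_power) simp
  qed (use r abs_Re_unit[OF that] in \<open>simp_all add: power_le_one\<close>)
  have "emeasure (poisson_kernel r \<psi> \<circledast> \<nu>) (space (poisson_kernel r \<psi> \<circledast> \<nu>)) = (\<integral>\<^sup>+z. 1 \<partial>(poisson_kernel r \<psi> \<circledast> \<nu>))"
    by simp
  also have "\<dots> = (\<integral>\<^sup>+z. 1 \<partial>poisson_kernel r \<psi>)"
    using nn_integral_circle_conv[OF S sN, of "\<lambda>_. 1"] by (simp add: N.emeasure_space_1)
  also have "\<dots> = (\<integral>\<^sup>+z. ennreal (poisson r (cnj (cis \<psi>) * z)) \<partial>arc_measure)"
    by (subst circle_rep_integral[OF poisson_kernel_rep]) auto
  also have "\<dots> \<le> (\<integral>\<^sup>+z. ennreal ((1 - r\<^sup>2) / (2 * pi * (1 - r)\<^sup>2)) \<partial>arc_measure)"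
    by (intro nn_integral_mono ennreal_leI bound) (auto simp: norm_mult)
  also have "\<dots> < \<top>"
    by (simp add: emeasure_arc_space ennreal_mult_less_top)
  finally show "emeasure (poisson_kernel r \<psi> \<circledast> \<nu>) (space (poisson_kernel r \<psi> \<circledast> \<nu>)) \<noteq> \<infinity>"
    by simp
qed

text \<open>Here \<open>u\<close> and \<open>v\<close> stand for cosines of the two positions,
  \<open>k\<close> for cos t, and \<open>q\<close>, \<open>p\<close> for products of sines. The
  latter enter through their squares only, because the sum of the two fractions is 2 (A - B k x) / D
  x with A = 1 + r^2 and B = 2 r.\<close>

lemma poisson_pair_mono:
  fixes r k u v q p :: real
  assumes r: "0 < r" "r < 1" and k: "4 * r \<le> k" "k \<le> 1" and uv: "v \<le> u" "\<bar>u\<bar> \<le> 1" "\<bar>v\<bar> \<le> 1"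
    and q: "q\<^sup>2 = (1 - u\<^sup>2) * (1 - k\<^sup>2)" and p: "p\<^sup>2 = (1 - v\<^sup>2) * (1 - k\<^sup>2)"
    and pos: "0 < 1 + r\<^sup>2 - 2 * r * (u * k + q)" "0 < 1 + r\<^sup>2 - 2 * r * (u * k - q)"
      "0 < 1 + r\<^sup>2 - 2 * r * (v * k + p)" "0 < 1 + r\<^sup>2 - 2 * r * (v * k - p)"
  shows "1 / (1 + r\<^sup>2 - 2 * r * (v * k + p)) + 1 / (1 + r\<^sup>2 - 2 * r * (v * k - p))
       \<le> 1 / (1 + r\<^sup>2 - 2 * r * (u * k + q)) + 1 / (1 + r\<^sup>2 - 2 * r * (u * k - q))"
proof -
  define A where "A = 1 + r\<^sup>2"
  define B where "B = 2 * r"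
  define D where "D x = A\<^sup>2 - B\<^sup>2 * (1 - k\<^sup>2) - 2 * A * B * k * x + B\<^sup>2 * x\<^sup>2" for x
  have pair: "1 / (A - B * (x * k + y)) + 1 / (A - B * (x * k - y)) = 2 * (A - B * k * x) / D x \<and> 0 < D x"
    if "y\<^sup>2 = (1 - x\<^sup>2) * (1 - k\<^sup>2)" "0 < A - B * (x * k + y)" "0 < A - B * (x * k - y)" for x y
  proof -
    have *: "(A - B * (x * k + y)) * (A - B * (x * k - y)) = D x"
    proof -
      have "(A - B * (x * k + y)) * (A - B * (x * k - y)) = (A - B * x * k)\<^sup>2 - B\<^sup>2 * y\<^sup>2"
        by (simp add: power2_eq_square algebra_simps)
      also have "\<dots> = D x" unfolding that(1) D_def by (simp add: power2_eq_square algebra_simps)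
      finally show ?thesis .
    qed
    show ?thesis
      unfolding *[symmetric] using that by (simp add: add_frac_eq mult_pos_pos) (simp add: algebra_simps)
  qed
  have AB: "0 < B" "B \<le> A" "2 * B \<le> A * k"
  proof -
    show "0 < B" using r by (simp add: B_def)
    show "B \<le> A" using sum_squares_bound[of r 1] by (simp add: A_def B_def)
    have "2 * B \<le> 1 * k" using k by (simp add: B_def)
    also have "\<dots> \<le> A * k" using k r by (intro mult_right_mono) (auto simp: A_def)
    finally show "2 * B \<le> A * k" .
  qed
  have "0 \<le> k" using k r by simp
  define s where "s = 2 - u - v"
  have s: "0 \<le> s" using uv by (simp add: s_def)
  have "0 \<le> (1 - u) * (1 - v)" using uv by simp
  then have uvs: "u + v - 1 \<le> u * v" by (simp add: algebra_simps)
  \<comment> \<open>This is the factor left over when the two quotients are cross-multiplied and (u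
    - v) B is taken out. With s = 2 - u - v it is at least A (A k - 2 B) + B s (A - k B); the
    hypothesis 4 r <= k enters as 2 B <= A k.\<close>
  have E: "0 \<le> A\<^sup>2 * k - A * B * (u + v) + k * B\<^sup>2 * (1 - k\<^sup>2 + u * v)"
  proof -
    have "k * B\<^sup>2 * (- s) \<le> k * B\<^sup>2 * (1 - k\<^sup>2 + u * v)"
      using uvs \<open>0 \<le> k\<close> k power_le_one[of k 2] by (intro mult_left_mono) (auto simp: s_def)
    moreover have "A * (2 * B) \<le> A * (A * k)"
      using AB by (intro mult_left_mono) auto
    moreover have "k * B \<le> 1 * B"
      using AB k by (intro mult_right_mono) auto
    then have "0 \<le> A - k * B"
      using AB by linarith
    then have "0 \<le> B * s * (A - k * B)"
      using AB s by (intro mult_nonneg_nonneg) simp_all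
    ultimately show ?thesis
      by (simp add: s_def power2_eq_square algebra_simps)
  qed
  have "(A - B * k * u) * D v - (A - B * k * v) * D u
      = (u - v) * B * (A\<^sup>2 * k - A * B * (u + v) + k * B\<^sup>2 * (1 - k\<^sup>2 + u * v))"
    by (simp add: D_def power2_eq_square algebra_simps)
  also have "\<dots> \<ge> 0" using E uv AB by (intro mult_nonneg_nonneg) auto
  finally have le: "(A - B * k * v) * D u \<le> (A - B * k * u) * D v" by simp
  note pu = pair[OF q pos(1,2)[folded A_def B_def]] and pv = pair[OF p pos(3,4)[folded A_def B_def]]
  have "2 * (A - B * k * v) / D v \<le> 2 * (A - B * k * u) / D u"
    unfolding pos_divide_le_eq[OF pv[THEN conjunct2]] times_divide_eq_left pos_le_divide_eq[OF pu[THEN conjunct2]]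
    using le by (simp only: mult.assoc mult_le_cancel_left_pos zero_less_numeral)
  then show ?thesis
    unfolding A_def[symmetric] B_def[symmetric] pu[THEN conjunct1] pv[THEN conjunct1] .
qed

lemma poisson_conv_pair_mono:
  assumes r: "0 < r" "r < 1" and w: "cmod w = 1" "4 * r \<le> Re w"
    and xy: "cmod x = 1" "cmod y = 1" "Re x \<le> Re y"
  shows "poisson r (x * cnj w) + poisson r (x * w) \<le> poisson r (y * cnj w) + poisson r (y * w)"
proof -
  have Im2: "(Im z)\<^sup>2 = 1 - (Re z)\<^sup>2" if "cmod z = 1" for z
    using that cmod_power2[of z] by simp
  have unit: "cmod (z * cnj w) = 1" "cmod (z * w) = 1" if "cmod z = 1" for z
    using that w by (simp_all add: norm_mult)
  have pz: "poisson r (z * cnj w) + poisson r (z * w) = (1 - r\<^sup>2) / (2 * pi) *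
     (1 / (1 + r\<^sup>2 - 2 * r * (Re z * Re w + Im z * Im w)) + 1 / (1 + r\<^sup>2 - 2 * r * (Re z * Re w - Im z * Im w)))"
    if "cmod z = 1" for z
    using unit[OF that] by (simp add: poisson_unit distrib_left)
  have pos: "0 < 1 + r\<^sup>2 - 2 * r * (Re z * Re w + Im z * Im w)" "0 < 1 + r\<^sup>2 - 2 * r * (Re z * Re w - Im z * Im w)"
    if "cmod z = 1" for z
    using poisson_denom_pos[OF r abs_Re_unit[OF unit(1)[OF that]]]
      poisson_denom_pos[OF r abs_Re_unit[OF unit(2)[OF that]]] by simp_all
  have w1: "Re w \<le> 1" using abs_Re_unit[OF w(1)] by linarith
  show ?thesis
    unfolding pz[OF xy(1)] pz[OF xy(2)]
    using w(2) xy pos[OF xy(1)] pos[OF xy(2)]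
    by (intro mult_left_mono poisson_pair_mono)
       (auto simp: power_mult_distrib Im2 w w1 r abs_Re_unit power_le_one less_imp_le intro!: divide_nonneg_nonneg)
qed

lemma circle_unimodal_poisson_conv:
  assumes \<phi>: "0 < \<phi>" "\<phi> < pi / 2" and \<mu>: "circle_prob \<mu>" "circle_symmetric \<mu>"
    and supp: "AE \<xi> in \<mu>. \<xi> \<in> cis ` {-\<phi>..\<phi>}" and r: "0 < r" "r < cos \<phi> / 4"
  shows "circle_unimodal (poisson_kernel r \<psi> \<circledast> \<mu>)"
proof -
  have S: "sets \<mu> = sets circle_borel" using \<mu> by (simp add: circle_prob_def)
  note S [measurable_cong]
  interpret prob_space \<mu> using \<mu> by (simp add: circle_prob_def)
  have r1: "r < 1" using r(2) cos_le_one[of \<phi>] by linarith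
  define H where "H z = (\<integral>\<^sup>+w. ennreal (poisson r (z * cnj w)) \<partial>\<mu>)" for z
  have [measurable]: "H \<in> borel_measurable circle_borel"
    unfolding H_def by measurable
  \<comment> \<open>The symmetry of \<open>\<mu>\<close> allows \<open>w\<close> to be paired with
    \<open>cnj w\<close>, since a single shifted kernel does not increase with the real
    part.\<close>
  have H2: "2 * H z = (\<integral>\<^sup>+w. ennreal (poisson r (z * cnj w) + poisson r (z * w)) \<partial>\<mu>)" if "cmod z = 1" for z
  proof -
    have "H z = (\<integral>\<^sup>+w. ennreal (poisson r (z * w)) \<partial>\<mu>)"
      unfolding H_def using circle_symmetric_nn_integral[OF \<mu>(2) S, of "\<lambda>w. ennreal (poisson r (z * w))"] that
      by simp
    then have "2 * H z = (\<integral>\<^sup>+w. ennreal (poisson r (z * cnj w)) \<partial>\<mu>) + (\<integral>\<^sup>+w. ennreal (poisson r (z * w)) \<partial>\<mu>)"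
      by (simp add: mult_2 H_def)
    also have "\<dots> = (\<integral>\<^sup>+w. ennreal (poisson r (z * cnj w)) + ennreal (poisson r (z * w)) \<partial>\<mu>)"
      using that by (intro nn_integral_add[symmetric]) simp_all
    also have "\<dots> = (\<integral>\<^sup>+w. ennreal (poisson r (z * cnj w) + poisson r (z * w)) \<partial>\<mu>)"
      using r(1) r1 by (simp add: poisson_nonneg ennreal_plus)
    finally show ?thesis .
  qed
  have "re_mono H"
    unfolding re_mono_def
  proof (intro allI impI)
    fix x y assume xy: "cmod x = 1" "cmod y = 1" "Re x \<le> Re y"
    have "2 * H x \<le> 2 * H y"
      unfolding H2[OF xy(1)] H2[OF xy(2)]
    proof (rule nn_integral_mono_AE)
      show "AE w in \<mu>. ennreal (poisson r (x * cnj w) + poisson r (x * w))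
          \<le> ennreal (poisson r (y * cnj w) + poisson r (y * w))"
        using supp
      proof eventually_elim
        case (elim w)
        then obtain t where t: "w = cis t" "\<bar>t\<bar> \<le> \<phi>" by auto
        have "cos \<phi> \<le> cos \<bar>t\<bar>" using t \<phi> by (intro cos_monotone_0_pi_le) auto
        then have "4 * r \<le> Re w" using r t by simp
        then show ?case
          using r r1 xy t by (intro ennreal_leI poisson_conv_pair_mono) auto
      qed
    qed
    then show "H x \<le> H y" by (simp add: ennreal_mult_le_mult_iff)
  qed
  moreover have "circle_rep (poisson_kernel r \<psi> \<circledast> \<mu>) 0 (cis \<psi>) (\<lambda>z. H (cnj (cis \<psi>) * z))"
    using poisson_conv_rep[OF \<mu>(1), of "cis \<psi>"] by (simp add: H_def)
  ultimately show ?thesis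
    using finite_measure_poisson_conv[OF r(1) r1 \<mu>(1)] by (intro circle_unimodalI) auto
qed

section \<open>A criterion for non-unimodality\<close>

text \<open>Otherwise an interval of angles of positive length would be mapped into a null set. This
  turns almost everywhere identities of densities into statements at points near a prescribed
  angle.\<close>

lemma AE_arc_dense:
  assumes Q: "AE z in arc_measure. Q z" and "eventually P (nhds (t0::real))" and e: "0 < e"
  shows "\<exists>t. P t \<and> Q (cis t) \<and> \<bar>t - t0\<bar> < e"
proof -
  obtain d where d: "0 < d" "\<And>t. \<bar>t - t0\<bar> < d \<Longrightarrow> P t"
    using assms(2) by (auto simp: eventually_nhds_metric dist_real_def)
  \<comment> \<open>The bound \<open>pi\<close> keeps the interval inside one window of length
    \<open>2 * pi\<close>.\<close>
  define u where "u = min (min d e) pi"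
  have u: "0 < u" "u \<le> d" "u \<le> e" "u < 2 * pi" using d e pi_gt_zero by (auto simp: u_def min_def)
  obtain N where N: "N \<in> null_sets arc_measure" "\<And>z. z \<in> sphere 0 1 - N \<Longrightarrow> Q z"
    using Q by (auto elim!: AE_E3)
  then have [measurable]: "N \<in> sets circle_borel" by auto
  show ?thesis
  proof (rule ccontr)
    assume none: "\<not> ?thesis"
    have "cis t \<in> N" if "t0 < t" "t < t0 + u" for t
    proof -
      have "P t" "\<bar>t - t0\<bar> < e" using d(2)[of t] u that by auto
      then have "\<not> Q (cis t)" using none by blast
      then show ?thesis using N(2)[of "cis t"] by auto
    qed
    then have "(\<integral>\<^sup>+t. indicator {t0<..<t0 + u} t \<partial>lborel)
        \<le> (\<integral>\<^sup>+t. indicator N (cis t) * indicator {t0..<t0 + 2 * pi} t \<partial>lborel)"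
      using u by (intro nn_integral_mono) (auto split: split_indicator)
    also have "\<dots> = (\<integral>\<^sup>+z. indicator N z \<partial>arc_measure)"
      by (rule nn_integral_arc_window[symmetric]) measurable
    also have "\<dots> = 0" using N by (simp add: null_setsD1)
    finally show False using u by simp
  qed
qed

text \<open>The density of a unimodal representation agrees with \<open>K\<close> almost everywhere
  only. The bounds are therefore asked for on neighbourhoods, and the four angles are moved slightly
  to points of agreement that avoid the mode.\<close>

lemma not_circle_unimodalI:
  assumes rep: "circle_rep \<mu> 0 s K"
    and ord: "a < b" "b < c" "c < d" "d < a + 2 * pi"
    and ev: "\<forall>\<^sub>F t in nhds a. M < K (cis t)" "\<forall>\<^sub>F t in nhds c. M < K (cis t)"
      "\<forall>\<^sub>F t in nhds b. K (cis t) < M" "\<forall>\<^sub>F t in nhds d. K (cis t) < M"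
  shows "\<not> circle_unimodal \<mu>"
proof
  assume "circle_unimodal \<mu>"
  then obtain \<phi> c' F where rep': "circle_rep \<mu> c' (cis \<phi>) F" and v: "v_shaped \<phi> F"
    by (rule circle_unimodal_rep)
  have "AE z in arc_measure. z \<noteq> cis \<phi>" by (rule AE_arc_neq) simp
  with circle_rep_unique_AE[OF rep rep'] have AE: "AE z in arc_measure. K z = F z \<and> z \<noteq> cis \<phi>"
    by eventually_elim simp
  \<comment> \<open>Half of every gap, including the one across the full turn: neighbouring angles
    that each move by less than this keep their order.\<close>
  define e where "e = Min {(b - a) / 2, (c - b) / 2, (d - c) / 2, (a + 2 * pi - d) / 2}"
  have e: "0 < e" using ord by (auto simp: e_def)
  have "e \<le> (b - a) / 2" "e \<le> (c - b) / 2" "e \<le> (d - c) / 2" "e \<le> (a + 2 * pi - d) / 2"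
    unfolding e_def by (rule Min_le; simp)+
  note e = e this
  obtain a' where a': "M < K (cis a')" "K (cis a') = F (cis a')" "cis a' \<noteq> cis \<phi>" "\<bar>a' - a\<bar> < e"
    using AE_arc_dense[OF AE ev(1) e(1)] by auto
  obtain c'' where c': "M < K (cis c'')" "K (cis c'') = F (cis c'')" "cis c'' \<noteq> cis \<phi>" "\<bar>c'' - c\<bar> < e"
    using AE_arc_dense[OF AE ev(2) e(1)] by auto
  obtain b' where b': "K (cis b') < M" "K (cis b') = F (cis b')" "cis b' \<noteq> cis \<phi>" "\<bar>b' - b\<bar> < e"
    using AE_arc_dense[OF AE ev(3) e(1)] by auto
  obtain d' where d': "K (cis d') < M" "K (cis d') = F (cis d')" "cis d' \<noteq> cis \<phi>" "\<bar>d' - d\<bar> < e"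
    using AE_arc_dense[OF AE ev(4) e(1)] by auto
  have "a' < b'" "b' < c''" "c'' < d'" "d' < a' + 2 * pi"
    using a'(4) b'(4) c'(4) d'(4) e unfolding abs_diff_less_iff by (auto simp: field_simps)
  from v_shaped_four_points[OF v this a'(3) b'(3) c'(3) d'(3)]
  have "min (F (cis a')) (F (cis c'')) \<le> max (F (cis b')) (F (cis d'))" .
  moreover have "M < min (F (cis a')) (F (cis c''))" "max (F (cis b')) (F (cis d')) < M"
    using a' b' c' d' by simp_all
  ultimately show False by (meson less_le_trans less_irrefl less_trans)
qed

lemma continuous_on_circle_cis:
  assumes "continuous_on (sphere 0 1) (h :: complex \<Rightarrow> real)"
  shows "isCont (\<lambda>t. h (cis t)) t"
proof -
  have "continuous_on UNIV (\<lambda>t. h (cis t))"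
    by (rule continuous_on_compose2[OF assms]) (auto intro: continuous_intros)
  then show ?thesis by (simp add: continuous_on_eq_continuous_at)
qed

lemma continuous_circle_measurable:
  assumes "continuous_on (sphere 0 1) (h :: complex \<Rightarrow> real)"
  shows "h \<in> borel_measurable circle_borel"
  unfolding circle_borel_def by (rule borel_measurable_continuous_on_restrict[OF assms])

text \<open>A difference at one point persists nearby by continuity, against agreement almost
  everywhere; nonnegativity carries equality from \<open>ennreal\<close> back to the reals. Hence
  (3) can be checked on one explicit density.\<close>

lemma continuous_density_unique:
  assumes f: "continuous_density \<mu> f" and g: "continuous_density \<mu> g" and z: "z \<in> sphere 0 1"
  shows "f z = g z"
proof (rule ccontr)
  assume ne: "f z \<noteq> g z"
  have cf: "continuous_on (sphere 0 1) f" and cg: "continuous_on (sphere 0 1) g"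
    and nn: "\<And>z. z \<in> sphere 0 1 \<Longrightarrow> 0 \<le> f z \<and> 0 \<le> g z"
    and rep: "circle_rep \<mu> 0 1 (\<lambda>z. ennreal (f z))" "circle_rep \<mu> 0 1 (\<lambda>z. ennreal (g z))"
    using f g circle_rep_angle_density[OF continuous_circle_measurable[of f]]
      circle_rep_angle_density[OF continuous_circle_measurable[of g]]
    by (auto simp: continuous_density_def)
  obtain t where t: "z = cis t" using z by (auto elim: circle_norm_cisE)
  have "isCont (\<lambda>t. f (cis t) - g (cis t)) t"
    by (intro continuous_diff continuous_on_circle_cis cf cg)
  then have "((\<lambda>t. f (cis t) - g (cis t)) \<longlongrightarrow> f (cis t) - g (cis t)) (nhds t)"
    by (simp add: continuous_at tendsto_nhds_iff)
  then have "\<forall>\<^sub>F u in nhds t. f (cis u) - g (cis u) \<noteq> 0"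
    using ne t by (intro tendsto_imp_eventually_ne) auto
  from AE_arc_dense[OF circle_rep_unique_AE[OF rep] this, of 1]
  show False using nn[of "cis _"] by auto
qed

section \<open>The Poisson kernel and the two-point measure\<close>

lemma circle_prob_sym_bernoulli: "circle_prob sym_bernoulli"
  and nn_integral_sym_bernoulli: "G \<in> borel_measurable circle_borel \<Longrightarrow>
    (\<integral>\<^sup>+z. G z \<partial>sym_bernoulli) = (G (- 1) + G 1) / 2"
proof -
  have S: "sets sym_bernoulli = sets circle_borel" by (simp add: sym_bernoulli_def)
  have int: "(\<integral>\<^sup>+z. G z \<partial>sym_bernoulli) = (G (- 1) + G 1) / 2"
    if [measurable]: "G \<in> borel_measurable circle_borel" for G
  proof -
    have "G \<in> borel_measurable (add_measure (return circle_borel (- 1)) (return circle_borel 1))"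
      "G \<in> borel_measurable (return circle_borel (- 1))"
      by (subst measurable_cong_sets[of _ circle_borel borel borel]; simp)+
    then have "(\<integral>\<^sup>+z. G z \<partial>sym_bernoulli) = 1 / 2 * (G (- 1) + G 1)"
      unfolding sym_bernoulli_def
      by (subst nn_integral_scale_measure)
         (simp_all add: nn_integral_add_measure nn_integral_return)
    then show ?thesis by (simp add: ennreal_times_divide mult.commute[of "1/2"])
  qed
  show "(\<integral>\<^sup>+z. G z \<partial>sym_bernoulli) = (G (- 1) + G 1) / 2" if "G \<in> borel_measurable circle_borel"
    using that by (rule int)
  have "emeasure sym_bernoulli (space sym_bernoulli) = (\<integral>\<^sup>+z. 1 \<partial>sym_bernoulli)" by simp
  also have "\<dots> = 1" by (subst int) (simp_all add: one_add_one)
  finally show "circle_prob sym_bernoulli"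
    using S by (auto simp: circle_prob_def intro: prob_spaceI)
qed

definition two_peak :: "real \<Rightarrow> complex \<Rightarrow> real" where
  "two_peak r z = (poisson r z + poisson r (- z)) / 2"

text \<open>Over a common denominator the sum is a positive constant divided by A^2 - 4 r^2 (Re
  z)^2, where A = 1 + r^2.\<close>

lemma two_peak_strict_mono:
  assumes r: "0 < r" "r < 1" and xy: "cmod x = 1" "cmod y = 1" "\<bar>Re x\<bar> < \<bar>Re y\<bar>"
  shows "two_peak r x < two_peak r y"
proof -
  define A where "A = 1 + r\<^sup>2"
  have "r\<^sup>2 < 1" using r by (simp add: power_less_one_iff)
  have eq: "two_peak r z = (1 - r\<^sup>2) * A / (2 * pi * (A\<^sup>2 - 4 * r\<^sup>2 * (Re z)\<^sup>2)) \<and> 0 < A\<^sup>2 - 4 * r\<^sup>2 * (Re z)\<^sup>2"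
    if z: "cmod z = 1" for z
  proof -
    have pos: "0 < A - 2 * r * Re z" "0 < A + 2 * r * Re z"
      using poisson_denom_pos[OF r, of "Re z"] poisson_denom_pos[OF r, of "- Re z"] abs_Re_unit[OF z]
      by (simp_all add: A_def)
    have "A\<^sup>2 - 4 * r\<^sup>2 * (Re z)\<^sup>2 = (A - 2 * r * Re z) * (A + 2 * r * Re z)"
      by (simp add: power2_eq_square algebra_simps)
    moreover have "two_peak r z = ((1 - r\<^sup>2) / (2 * pi * (A - 2 * r * Re z)) + (1 - r\<^sup>2) / (2 * pi * (A + 2 * r * Re z))) / 2"
      using z by (simp add: two_peak_def poisson_unit A_def)
    moreover have "\<dots> = (1 - r\<^sup>2) * A / (2 * pi * ((A - 2 * r * Re z) * (A + 2 * r * Re z)))"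
      using pos by (simp add: divide_simps) (simp add: algebra_simps)
    ultimately show ?thesis using pos by simp
  qed
  have "(Re x)\<^sup>2 < (Re y)\<^sup>2" using power_strict_mono[OF xy(3), of 2] by simp
  then have "4 * r\<^sup>2 * (Re x)\<^sup>2 < 4 * r\<^sup>2 * (Re y)\<^sup>2" using r by simp
  then show ?thesis
    using eq[OF xy(1)] eq[OF xy(2)] \<open>r\<^sup>2 < 1\<close> pi_gt_zero
    by (auto intro!: divide_strict_left_mono mult_strict_left_mono mult_pos_pos simp: A_def add_pos_nonneg)
qed

lemma poisson_conv_sym_bernoulli:
  assumes r: "0 < r" "r < 1"
  defines "h \<equiv> \<lambda>z \<psi>. two_peak r (cnj (cis \<psi>) * z)"
  shows "continuous_density (poisson_kernel r \<psi> \<circledast> sym_bernoulli) (\<lambda>z. h z \<psi>)"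
proof -
  have c: "continuous_on (sphere 0 1) (\<lambda>z. h z \<psi>)"
    unfolding h_def two_peak_def
    by (intro continuous_intros continuous_on_compose2[OF continuous_on_poisson[OF r]]) (auto simp: norm_mult)
  have "circle_rep (poisson_kernel r \<psi> \<circledast> sym_bernoulli) 0 1 (\<lambda>z. ennreal (h z \<psi>))"
  proof (rule circle_rep_cong[OF poisson_conv_rep[OF circle_prob_sym_bernoulli, of 1]])
    show "AE z in arc_measure. (\<integral>\<^sup>+w. ennreal (poisson r (cnj (cis \<psi>) * z * cnj w)) \<partial>sym_bernoulli) = ennreal (h z \<psi>)"
    proof (rule AE_I2)
      fix z :: complex
      show "(\<integral>\<^sup>+w. ennreal (poisson r (cnj (cis \<psi>) * z * cnj w)) \<partial>sym_bernoulli) = ennreal (h z \<psi>)"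
        using r by (subst nn_integral_sym_bernoulli)
          (simp_all add: h_def two_peak_def poisson_nonneg add.commute ennreal_plus[symmetric] del: ennreal_plus
            flip: ennreal_divide_numeral ennreal_numeral)
    qed
  qed (use continuous_circle_measurable[OF c] in auto)
  then have "poisson_kernel r \<psi> \<circledast> sym_bernoulli = angle_density {-pi..<pi} (\<lambda>t. h (cis t) \<psi>)"
    by (rule circle_rep_measure_eqI[OF _ circle_rep_angle_density[OF continuous_circle_measurable[OF c]]])
  with c show ?thesis
    using r by (auto simp: continuous_density_def h_def two_peak_def poisson_nonneg)
qed

lemma continuous_density_poisson_conv_sym_bernoulli:
  assumes r: "0 < r" "r < 1" and f: "continuous_density (poisson_kernel r \<psi> \<circledast> sym_bernoulli) f"
  shows "f (cis \<psi>) = f (- cis \<psi>)" 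
    and "\<xi> \<in> sphere 0 1 - {cis \<psi>, - cis \<psi>} \<Longrightarrow> f \<xi> < f (cis \<psi>)"
proof -
  have f_eq: "f z = two_peak r (cnj (cis \<psi>) * z)" if "cmod z = 1" for z
    using continuous_density_unique[OF f poisson_conv_sym_bernoulli[OF r], of z] that by simp
  show "f (cis \<psi>) = f (- cis \<psi>)"
    by (simp add: f_eq cnj_mult_unit two_peak_def)
  show "f \<xi> < f (cis \<psi>)" if \<xi>: "\<xi> \<in> sphere 0 1 - {cis \<psi>, - cis \<psi>}"
  proof -
    define w where "w = cnj (cis \<psi>) * \<xi>"
    have w: "cmod w = 1" using \<xi> by (simp add: w_def norm_mult)
    have \<xi>w: "\<xi> = cis \<psi> * w" by (simp add: w_def mult.assoc[symmetric] cnj_mult_unit)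
    have "\<bar>Re w\<bar> \<noteq> 1"
    proof
      assume *: "\<bar>Re w\<bar> = 1"
      then have "(Re w)\<^sup>2 = 1" by (metis power2_abs one_power2)
      then have "Im w = 0" using w cmod_power2[of w] by simp
      with * have "w = 1 \<or> w = -1" by (auto simp: complex_eq_iff abs_if split: if_splits)
      then show False using \<xi> \<xi>w by auto
    qed
    then have "\<bar>Re w\<bar> < \<bar>Re 1\<bar>" using abs_Re_unit[OF w] by simp
    from two_peak_strict_mono[OF r w _ this] show ?thesis
      using \<xi> by (simp add: f_eq cnj_mult_unit w_def)
  qed
qed

text \<open>The test angles are the two peaks and the two troughs a quarter turn away from them,
  with a level halfway between.\<close>

lemma not_circle_unimodal_poisson_conv_sym_bernoulli:
  assumes r: "0 < r" "r < 1"
  shows "\<not> circle_unimodal (poisson_kernel r \<psi> \<circledast> sym_bernoulli)"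
proof -
  define h where "h z = two_peak r (cnj (cis \<psi>) * z)" for z
  have cd: "continuous_density (poisson_kernel r \<psi> \<circledast> sym_bernoulli) h"
    unfolding h_def by (rule poisson_conv_sym_bernoulli[OF r])
  then have c: "continuous_on (sphere 0 1) h" and nn: "\<And>t. 0 \<le> h (cis t)"
    by (auto simp: continuous_density_def)
  have rep: "circle_rep (poisson_kernel r \<psi> \<circledast> sym_bernoulli) 0 1 (\<lambda>z. ennreal (h z))"
    using cd circle_rep_angle_density[OF continuous_circle_measurable[OF c]] by (auto simp: continuous_density_def)
  have hcis: "h (cis t) = two_peak r (cis (t - \<psi>))" for t
    by (simp add: h_def cis_cnj cis_mult)
  define M where "M = (two_peak r \<i> + two_peak r 1) / 2"
  have "two_peak r \<i> < two_peak r 1" by (rule two_peak_strict_mono[OF r]) auto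
  then have M: "two_peak r \<i> < M" "M < two_peak r 1" by (simp_all add: M_def)
  have sym: "two_peak r (-1) = two_peak r 1" "two_peak r (-\<i>) = two_peak r \<i>"
    by (simp_all add: two_peak_def)
  have lim: "((\<lambda>t. h (cis t)) \<longlongrightarrow> h (cis u)) (nhds u)" for u
    using continuous_on_circle_cis[OF c, of u] by (simp add: continuous_at tendsto_nhds_iff)
  have vals: "h (cis \<psi>) = two_peak r 1" "h (cis (\<psi> + pi)) = two_peak r 1"
    "h (cis (\<psi> + pi / 2)) = two_peak r \<i>" "h (cis (\<psi> + 3 * pi / 2)) = two_peak r \<i>"
  proof -
    have "cis (3 * pi / 2) = cis pi * cis (pi / 2)" unfolding cis_mult by (simp add: field_simps)
    then have "cis (3 * pi / 2) = - \<i>" by simp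
    then show "h (cis \<psi>) = two_peak r 1" "h (cis (\<psi> + pi)) = two_peak r 1"
      "h (cis (\<psi> + pi / 2)) = two_peak r \<i>" "h (cis (\<psi> + 3 * pi / 2)) = two_peak r \<i>"
      by (simp_all add: hcis sym)
  qed
  have up: "\<forall>\<^sub>F t in nhds u. ennreal M < ennreal (h (cis t))" if "M < h (cis u)" for u
    using order_tendstoD(1)[OF lim that] by eventually_elim (simp add: M_def two_peak_def poisson_nonneg r ennreal_less_iff)
  have down: "\<forall>\<^sub>F t in nhds u. ennreal (h (cis t)) < ennreal M" if "h (cis u) < M" for u
    using order_tendstoD(2)[OF lim that] by eventually_elim (simp add: nn ennreal_less_iff)
  show ?thesis
    by (rule not_circle_unimodalI[OF rep, of \<psi> "\<psi> + pi / 2" "\<psi> + pi" "\<psi> + 3 * pi / 2" "ennreal M"])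
       (use M pi_gt_zero in \<open>auto intro!: up down simp: vals\<close>)
qed

section \<open>A unimodal measure for the Poisson kernel near the boundary\<close>

text \<open>The complement of arctan y to a right angle is arctan (1 / y), which is at most 1 /
  y.\<close>

lemma arctan_ge: "0 < y \<Longrightarrow> pi / 2 - 1 / y \<le> arctan (y::real)"
  using arctan_inverse[of y] arctan_le_self[of "1 / y"] by (simp add: sgn_if inverse_eq_divide)

text \<open>In the variable T = tan (t / 2) the kernel is a Cauchy density scaled by (1 + r) / (1 -
  r), so its primitive is an arc tangent.\<close>

definition poisson_primitive :: "real \<Rightarrow> real \<Rightarrow> real" where
  "poisson_primitive r t = arctan ((1 + r) / (1 - r) * tan (t / 2)) / pi"

text \<open>With C and S the squares of cosine and sine of the half angle, 1 + r^2 - 2 r cos t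
  equals (1 - r)^2 C + (1 + r)^2 S; division by (1 - r)^2 C produces the term in
  \<open>\<kappa> * T\<close>.\<close>

lemma poisson_cis_tan:
  assumes r: "0 < r" "r < 1" and c: "cos (t / 2) \<noteq> 0"
  defines "\<kappa> \<equiv> (1 + r) / (1 - r)" and "T \<equiv> tan (t / 2)"
  shows "poisson r (cis t) = \<kappa> * (1 + T\<^sup>2) / (2 * pi * (1 + (\<kappa> * T)\<^sup>2))"
proof -
  define C where "C = (cos (t / 2))\<^sup>2"
  define S where "S = (sin (t / 2))\<^sup>2"
  have CS: "S = 1 - C" unfolding S_def C_def by (rule sin_squared_eq)
  have C: "0 < C" using c by (simp add: C_def)
  have T: "T\<^sup>2 = S / C" by (simp add: T_def tan_def power_divide C_def S_def)
  have r': "0 < (1 - r)\<^sup>2" "0 < (1 - r)" using r by simp_all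
  have cost: "cos t = C - S" using cos_double[of "t / 2"] by (simp add: C_def S_def)
  have "1 + r\<^sup>2 - 2 * r * cos t = (1 - r)\<^sup>2 * C + (1 + r)\<^sup>2 * S"
    unfolding cost CS by (simp add: power2_eq_square algebra_simps)
  moreover have "poisson r (cis t) = (1 - r\<^sup>2) / (2 * pi * (1 + r\<^sup>2 - 2 * r * cos t))"
    by (simp add: poisson_unit)
  moreover have "1 - r\<^sup>2 = (1 - r) * (1 + r)" by (simp add: power2_eq_square algebra_simps)
  ultimately have "poisson r (cis t) = (1 - r) * (1 + r) / (2 * pi * ((1 - r)\<^sup>2 * C + (1 + r)\<^sup>2 * S))"
    by simp
  moreover have "1 + T\<^sup>2 = 1 / C" using C by (simp add: T CS field_simps)
  moreover have "1 + (\<kappa> * T)\<^sup>2 = ((1 - r)\<^sup>2 * C + (1 + r)\<^sup>2 * S) / ((1 - r)\<^sup>2 * C)"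
    unfolding power_mult_distrib T \<kappa>_def power_divide using C r' by (simp add: add_frac_eq field_simps)
  moreover have "0 < (1 - r)\<^sup>2 * C + (1 + r)\<^sup>2 * S"
    using C r' by (intro add_pos_nonneg mult_pos_pos mult_nonneg_nonneg) (auto simp: S_def)
  ultimately show ?thesis
    using C r' by (simp add: \<kappa>_def power2_eq_square)
qed

lemma cos_half_pos: "-pi < t \<Longrightarrow> t < pi \<Longrightarrow> 0 < cos (t / 2)"
  by (rule cos_gt_zero_pi) auto

lemma DERIV_poisson_primitive:
  assumes r: "0 < r" "r < 1" and t: "-pi < t" "t < pi"
  shows "(poisson_primitive r has_real_derivative poisson r (cis t)) (at t)"
proof -
  have c: "cos (t / 2) \<noteq> 0" using cos_half_pos[OF t] by simp
  define \<kappa> where "\<kappa> = (1 + r) / (1 - r)"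
  have sec: "inverse ((cos (t / 2))\<^sup>2) = 1 + (tan (t / 2))\<^sup>2"
    unfolding tan_sec[OF c] by (rule power_inverse[symmetric])
  have eq: "inverse X * (\<kappa> * (Y * (1 / 2))) / pi = \<kappa> * Y / (2 * pi * X)" for X Y
    by (cases "X = 0") (simp_all add: field_simps)
  have "((\<lambda>t. arctan (\<kappa> * tan (t / 2)) / pi) has_real_derivative
      inverse (1 + (\<kappa> * tan (t / 2))\<^sup>2) * (\<kappa> * (inverse ((cos (t / 2))\<^sup>2) * (1 / 2))) / pi) (at t)"
    by (intro DERIV_cdivide DERIV_chain2[where f = arctan, OF DERIV_arctan] DERIV_cmult DERIV_ident
        DERIV_chain2[where f = tan and g = "\<lambda>t. t / 2" and x = t, OF DERIV_tan[OF c]])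
  then show ?thesis
    unfolding poisson_primitive_def[abs_def] poisson_cis_tan[OF r c] \<kappa>_def[symmetric] sec eq .
qed

lemma isCont_poisson_primitive:
  assumes "0 < r" "r < 1" "-pi < t" "t < pi" shows "isCont (poisson_primitive r) t"
  using DERIV_isCont[OF DERIV_poisson_primitive[OF assms]] .

text \<open>The bounds on \<open>t\<close> keep all angles \<open>t - u\<close> inside (-pi, pi),
  where the tangent of the half angle has no pole.\<close>

lemma nn_integral_poisson_arc:
  assumes r: "0 < r" "r < 1" and ab: "0 \<le> b" and t: "t - b > -pi" "t < pi"
  shows "(\<integral>\<^sup>+u. ennreal (poisson r (cis (t - u))) * indicator {0..b} u \<partial>lborel)
    = ennreal (poisson_primitive r t - poisson_primitive r (t - b))"
proof -
  have "(\<integral>\<^sup>+u. ennreal (poisson r (cis (t - u))) * indicator {0..b} u \<partial>lborel)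
    = ennreal ((- poisson_primitive r (t - b)) - (- poisson_primitive r (t - 0)))"
  proof (rule nn_integral_FTC_Icc[where F = "\<lambda>u. - poisson_primitive r (t - u)"])
    fix u assume u: "u \<in> {0..b}"
    have "(poisson_primitive r has_real_derivative poisson r (cis (t - u))) (at (t - u))"
      using u t by (intro DERIV_poisson_primitive r) auto
    moreover have "((\<lambda>u. t - u) has_real_derivative -1) (at u)"
      by (auto intro!: derivative_eq_intros)
    ultimately have "((\<lambda>u. poisson_primitive r (t - u)) has_real_derivative poisson r (cis (t - u)) * -1) (at u)"
      by (rule DERIV_chain2)
    from DERIV_minus[OF this]
    show "((\<lambda>u. - poisson_primitive r (t - u)) has_real_derivative poisson r (cis (t - u))) (at u)"
      by simp
  qed (use r ab in \<open>auto intro: poisson_nonneg\<close>)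
  then show ?thesis by simp
qed

text \<open>
  The atom at the mode has weight of order \<open>1 / \<kappa> \<approx> (1 - r) / 2\<close>, the width of the peak of the Poisson
  kernel, so that both summands of the convolution have the same size near the mode.
\<close>

definition arc_with_atom :: "real \<Rightarrow> complex measure" where
  "arc_with_atom g = add_measure
     (scale_measure (ennreal (g / (g + pi / 2))) (return circle_borel (cis 0)))
     (angle_density {-pi<..<-pi + 2 * pi} (\<lambda>t. indicator {0<..<pi / 2} t / (g + pi / 2)))"

text \<open>The mode is the initial point of the arc: before it the density is 0, after it constant
  and then 0.\<close>

lemma circle_unimodal_arc_with_atom:
  assumes "0 < g" shows "circle_unimodal (arc_with_atom g)"
  unfolding circle_unimodal_def arc_with_atom_def
  using assms pi_gt_zero
  by (intro exI[of _ 0] exI[of _ "-pi"] exI[of _ "g / (g + pi / 2)"]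
        exI[of _ "\<lambda>t. indicator {0<..<pi / 2} t / (g + pi / 2)"] conjI)
     (auto simp: monotone_on_def indicator_def divide_right_mono intro!: divide_nonneg_nonneg add_nonneg_nonneg)

lemma arc_with_atom_rep:
  "circle_rep (arc_with_atom g) (ennreal (g / (g + pi / 2))) 1
     (\<lambda>z. ennreal (indicator {0<..<pi / 2} (Arg z) / (g + pi / 2)))"
proof -
  have "circle_rep (arc_with_atom g) (ennreal (g / (g + pi / 2))) (cis 0)
     (\<lambda>z. ennreal (indicator {0<..<pi / 2} (Arg z) / (g + pi / 2)))"
    unfolding arc_with_atom_def
  proof (rule circle_rep_add_angle_density)
    show "(\<lambda>t. ennreal (indicator {0<..<pi / 2} t / (g + pi / 2)))
      \<in> borel_measurable (restrict_space lborel {- pi<..<- pi + 2 * pi})"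
      by (intro measurable_restrict_space1) measurable
    show "(\<lambda>z. ennreal (indicator {0<..<pi / 2} (Arg z) / (g + pi / 2))) \<in> borel_measurable circle_borel"
      by (intro borel_measurable_circleI) measurable
  qed (auto simp: Arg_cis)
  then show ?thesis by simp
qed

lemma nn_integral_arc_with_atom:
  assumes g: "0 < g" and [measurable]: "G \<in> borel_measurable circle_borel"
  shows "(\<integral>\<^sup>+z. G z \<partial>arc_with_atom g)
    = ennreal (1 / (g + pi / 2)) * (ennreal g * G 1 + (\<integral>\<^sup>+t. G (cis t) * indicator {0..pi / 2} t \<partial>lborel))"
proof -
  have k: "0 \<le> 1 / (g + pi / 2)" using g pi_gt_zero by simp
  have m: "(\<lambda>z. ennreal (indicator {0<..<pi / 2} (Arg z) / (g + pi / 2)) * G z) \<in> borel_measurable circle_borel"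
    by measurable
  have "(\<integral>\<^sup>+z. ennreal (indicator {0<..<pi / 2} (Arg z) / (g + pi / 2)) * G z \<partial>arc_measure)
      = (\<integral>\<^sup>+t. ennreal (1 / (g + pi / 2)) * (G (cis t) * indicator {0..pi / 2} t) \<partial>lborel)"
    unfolding nn_integral_arc_Ioo[OF m, of "-pi"]
  proof (rule nn_integral_cong_AE)
    show "AE t in lborel. ennreal (indicator {0<..<pi / 2} (Arg (cis t)) / (g + pi / 2)) * G (cis t)
          * indicator {- pi<..<- pi + 2 * pi} t
        = ennreal (1 / (g + pi / 2)) * (G (cis t) * indicator {0..pi / 2} t)"
      using AE_lborel_singleton[of 0] AE_lborel_singleton[of "pi / 2"]
    proof eventually_elim
      case (elim t)
      then show ?case
        by (cases "-pi < t \<and> t < pi") (auto simp: Arg_cis indicator_def)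
    qed
  qed
  also have "\<dots> = ennreal (1 / (g + pi / 2)) * (\<integral>\<^sup>+t. G (cis t) * indicator {0..pi / 2} t \<partial>lborel)"
    by (rule nn_integral_cmult) measurable
  moreover have "ennreal (g / (g + pi / 2)) = ennreal (1 / (g + pi / 2)) * ennreal g"
    using g k by (simp flip: ennreal_mult)
  ultimately show ?thesis
    by (simp add: circle_rep_integral[OF arc_with_atom_rep] distrib_left mult.assoc)
qed

lemma circle_prob_arc_with_atom:
  assumes "0 < g" shows "circle_prob (arc_with_atom g)"
proof -
  have "emeasure (arc_with_atom g) (space (arc_with_atom g)) = (\<integral>\<^sup>+z. 1 \<partial>arc_with_atom g)" by simp
  also have "\<dots> = ennreal (1 / (g + pi / 2)) * (ennreal g + ennreal (pi / 2))"
    using assms by (subst nn_integral_arc_with_atom) simp_all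
  also have "\<dots> = 1"
    using assms pi_gt_zero by (simp flip: ennreal_plus ennreal_mult add: add_pos_pos less_imp_neq[symmetric])
  finally show ?thesis
    by (auto simp: circle_prob_def arc_with_atom_def intro: prob_spaceI)
qed

text \<open>With tan (\<theta> / 2) = x / \<kappa>, pi times the unnormalised density is close to
  (8/5) / (1 + x^2) + arctan x + pi/2. The peak 8/5 at x = 0 is slightly above pi/2, the limit of
  arctan, and in between the sum is lower. The test angles are 0, the one with x = sqrt 3, the
  middle pi/4 of the arc, and -pi/4 outside it.\<close>

lemma not_strongly_unimodal_poisson_kernel:
  assumes r: "99 / 100 < r" "r < 1"
  shows "\<not> strongly_unimodal (poisson_kernel r \<psi>)"
proof -
  have r0: "0 < r" using r by simp
  define \<kappa> where "\<kappa> = (1 + r) / (1 - r)"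
  have \<kappa>: "199 < \<kappa>" using r by (simp add: \<kappa>_def field_simps)
  \<comment> \<open>The kernel has the value \<open>\<kappa> / (2 * pi)\<close> at its peak, so that
    pi times the contribution of the atom is exactly 8/5 there.\<close>
  define g where "g = 16 / (5 * \<kappa>)"
  have g: "0 < g" using \<kappa> by (simp add: g_def)
  define k where "k = 1 / (g + pi / 2)"
  have k: "0 < k" using g pi_gt_zero by (simp add: k_def add_pos_pos)
  \<comment> \<open>Up to the normalisation \<open>k\<close>, the density in the angle measured from
    \<open>\<psi>\<close>: the atom gives a multiple of the kernel, the arc a difference of
    primitives. It is used for angles between \<open>-pi / 2\<close> and \<open>pi\<close>.\<close>
  define w where "w \<theta> = g * poisson r (cis \<theta>) + (poisson_primitive r \<theta> - poisson_primitive r (\<theta> - pi / 2))" for \<theta>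
  define K where "K z = (\<integral>\<^sup>+w. ennreal (poisson r (cnj (cis \<psi>) * z * cnj w)) \<partial>arc_with_atom g)" for z
  have rep: "circle_rep (poisson_kernel r \<psi> \<circledast> arc_with_atom g) 0 1 K"
    unfolding K_def by (rule poisson_conv_rep[OF circle_prob_arc_with_atom[OF g]]) simp
  have mono: "poisson_primitive r (\<theta> - pi / 2) \<le> poisson_primitive r \<theta>" if "-pi / 2 < \<theta>" "\<theta> < pi" for \<theta>
  proof (rule DERIV_nonneg_imp_nondecreasing[where f = "poisson_primitive r"])
    fix x assume "\<theta> - pi / 2 \<le> x" "x \<le> \<theta>"
    then show "\<exists>y. (poisson_primitive r has_real_derivative y) (at x) \<and> 0 \<le> y"
      using that r0 r(2) by (intro exI[of _ "poisson r (cis x)"] conjI DERIV_poisson_primitive poisson_nonneg) auto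
  qed simp
  \<comment> \<open>\<open>\<psi>'\<close> is free up to full turns because the test angle -pi/4
    comes last in cyclic order and is taken one turn later, while the argument of \<open>w\<close>
    has to stay in its range.\<close>
  have Kw: "K (cis t) = ennreal (k * w (t - \<psi>'))"
    if \<psi>': "cis \<psi>' = cis \<psi>" and t: "-pi / 2 < t - \<psi>'" "t - \<psi>' < pi" for t \<psi>'
  proof -
    have c: "cnj (cis \<psi>') * cis t * cnj (cis u) = cis (t - \<psi>' - u)" for u
      unfolding cis_cnj cis_mult by (rule arg_cong[where f = cis]) simp
    have "cnj (cis \<psi>') * cis t * cnj 1 = cis (t - \<psi>')"
      using c[of 0] by simp
    then have "K (cis t) = ennreal k * (ennreal g * ennreal (poisson r (cis (t - \<psi>')))
        + (\<integral>\<^sup>+u. ennreal (poisson r (cis (t - \<psi>' - u))) * indicator {0..pi / 2} u \<partial>lborel))"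
      unfolding K_def \<psi>'[symmetric] k_def
      by (subst nn_integral_arc_with_atom[OF g]) (measurable, simp only: c)
    also have "\<dots> = ennreal k * (ennreal g * ennreal (poisson r (cis (t - \<psi>')))
        + ennreal (poisson_primitive r (t - \<psi>') - poisson_primitive r (t - \<psi>' - pi / 2)))"
      using t r0 r(2) by (subst nn_integral_poisson_arc) simp_all
    also have "\<dots> = ennreal (k * w (t - \<psi>'))"
    proof -
      have P: "0 \<le> poisson r (cis (t - \<psi>'))" by (rule poisson_nonneg[OF r0 r(2)])
      have D: "0 \<le> poisson_primitive r (t - \<psi>') - poisson_primitive r (t - \<psi>' - pi / 2)"
        using mono[OF t] by simp
      have gP: "0 \<le> g * poisson r (cis (t - \<psi>'))" using P g by simp
      show ?thesis
        unfolding w_def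
          ennreal_mult[OF less_imp_le[OF k] add_nonneg_nonneg[OF gP D]] ennreal_plus[OF gP D]
          ennreal_mult[OF less_imp_le[OF g] P] ..
    qed
    finally show ?thesis .
  qed
  have cont: "isCont w \<theta>" if "-pi / 2 < \<theta>" "\<theta> < pi" for \<theta>
  proof -
    have "isCont (\<lambda>\<theta>. \<theta> - pi / 2) \<theta>" by simp
    then have 1: "isCont (\<lambda>\<theta>. poisson_primitive r (\<theta> - pi / 2)) \<theta>"
      by (rule isCont_o2) (use that r0 r(2) in \<open>auto intro!: isCont_poisson_primitive\<close>)
    have 2: "isCont (poisson_primitive r) \<theta>"
      using that r0 r(2) pi_gt_zero by (intro isCont_poisson_primitive) auto
    have 3: "isCont (\<lambda>\<theta>. poisson r (cis \<theta>)) \<theta>"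
      by (rule continuous_on_circle_cis[OF continuous_on_poisson[OF r0 r(2)]])
    show ?thesis
      unfolding w_def[abs_def] by (intro isCont_add isCont_diff isCont_mult continuous_const 1 2 3)
  qed
  have ev: "(M < w \<theta> \<longrightarrow> (\<forall>\<^sub>F t in nhds (\<psi>' + \<theta>). ennreal (k * M) < K (cis t))) \<and>
      (w \<theta> < M \<longrightarrow> (\<forall>\<^sub>F t in nhds (\<psi>' + \<theta>). K (cis t) < ennreal (k * M)))"
    if \<theta>: "-pi / 2 < \<theta>" "\<theta> < pi" and M: "0 < M" and \<psi>': "cis \<psi>' = cis \<psi>" for \<theta> M \<psi>'
  proof -
    have "isCont (\<lambda>t. w (t - \<psi>')) (\<psi>' + \<theta>)"
      by (rule isCont_o2) (use cont[OF \<theta>] in simp_all)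
    then have lim: "((\<lambda>t. w (t - \<psi>')) \<longlongrightarrow> w \<theta>) (nhds (\<psi>' + \<theta>))"
      by (simp add: continuous_at tendsto_nhds_iff)
    have "\<forall>\<^sub>F t in nhds (\<psi>' + \<theta>). t \<in> {\<psi>' - pi / 2<..<\<psi>' + pi}"
      using \<theta> by (intro eventually_nhds_in_open) auto
    then have near: "\<forall>\<^sub>F t in nhds (\<psi>' + \<theta>). K (cis t) = ennreal (k * w (t - \<psi>'))"
      by eventually_elim (use \<psi>' in \<open>auto intro!: Kw\<close>)
    show ?thesis
    proof (intro conjI impI)
      assume "M < w \<theta>"
      from order_tendstoD(1)[OF lim this] near
      show "\<forall>\<^sub>F t in nhds (\<psi>' + \<theta>). ennreal (k * M) < K (cis t)"
        by eventually_elim (use k M in \<open>simp add: ennreal_less_iff\<close>)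
    next
      assume "w \<theta> < M"
      from order_tendstoD(2)[OF lim this] near
      show "\<forall>\<^sub>F t in nhds (\<psi>' + \<theta>). K (cis t) < ennreal (k * M)"
      proof eventually_elim
        case (elim t)
        then show ?case using k M by (simp add: ennreal_lessI)
      qed
    qed
  qed
  have piw: "pi * w \<theta> = 8 / 5 * (1 + (tan (\<theta> / 2))\<^sup>2) / (1 + (\<kappa> * tan (\<theta> / 2))\<^sup>2)
      + arctan (\<kappa> * tan (\<theta> / 2)) + arctan (\<kappa> * tan (pi / 4 - \<theta> / 2))"
    if "-pi / 2 < \<theta>" "\<theta> < pi" for \<theta>
  proof -
    have c: "cos (\<theta> / 2) \<noteq> 0" using cos_half_pos[of \<theta>] that pi_gt_zero by simp
    have "(\<theta> - pi / 2) / 2 = - (pi / 4 - \<theta> / 2)" by (simp add: field_simps)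
    then have "tan ((\<theta> - pi / 2) / 2) = - tan (pi / 4 - \<theta> / 2)" by (simp only: tan_minus)
    then have "pi * (poisson_primitive r \<theta> - poisson_primitive r (\<theta> - pi / 2))
        = arctan (\<kappa> * tan (\<theta> / 2)) + arctan (\<kappa> * tan (pi / 4 - \<theta> / 2))"
      unfolding poisson_primitive_def \<kappa>_def[symmetric] by (simp add: ring_distribs arctan_minus)
    moreover have "pi * (16 / (5 * \<kappa>) * (\<kappa> * X / (2 * pi * Y))) = 8 / 5 * X / Y" for X Y
      using \<kappa> by (cases "Y = 0") (simp_all add: field_simps)
    then have "pi * (g * poisson r (cis \<theta>)) = 8 / 5 * (1 + (tan (\<theta> / 2))\<^sup>2) / (1 + (\<kappa> * tan (\<theta> / 2))\<^sup>2)"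
      unfolding g_def poisson_cis_tan[OF r0 r(2) c] \<kappa>_def[symmetric] .
    ultimately show ?thesis
      unfolding w_def distrib_left by linarith
  qed
  \<comment> \<open>At the middle of the arc both ends are at distance pi/4, hence at half angle
    pi/8; at -pi/4 the same tangent occurs with a minus sign.\<close>
  define T where "T = tan (pi / 8)"
  have "pi / 8 \<le> T"
    using arctan_le_self[of T] arctan_tan[of "pi / 8"] pi_gt_zero by (simp add: T_def tan_pos_pi2_le)
  then have T: "3 / 8 < T" using pi_gt3 by simp
  have "199 * (3 / 8) < \<kappa> * T" using \<kappa> T by (intro mult_strict_mono) auto
  then have \<kappa>T: "74 < \<kappa> * T" by simp
  have arctanT: "pi / 2 - 1 / 74 < arctan (\<kappa> * T)"
  proof -
    have "1 / (\<kappa> * T) < 1 / 74" using \<kappa>T by (intro divide_strict_left_mono) auto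
    then show ?thesis using arctan_ge[of "\<kappa> * T"] \<kappa>T by linarith
  qed
  \<comment> \<open>For pi times \<open>w\<close> the estimates give more than 8/5 + pi/2 - 1/199 at
    0, less than 41/100 + pi/3 + pi/2 at the dip, more than pi - 1/37 at pi/4, and less than 8/5 +
    1/74 at -pi/4. The level pi - 1/20 separates them.\<close>
  define M where "M = (pi - 1 / 20) / pi"
  have M: "0 < M" using pi_gt3 by (simp add: M_def)
  have piM: "pi * M = pi - 1 / 20" by (simp add: M_def)
  \<comment> \<open>An angle inside the dip with exact values:
    \<open>\<kappa> * tan (\<theta> / 2)\<close> is sqrt 3, its arctan is pi/3, and the denominator
    1 + 3 reduces 8/5 to 2/5.\<close>
  define \<theta> where "\<theta> = 2 * arctan (sqrt 3 / \<kappa>)"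
  have "sqrt 3 < 2" by (rule real_less_lsqrt) auto
  then have s3: "0 < sqrt 3 / \<kappa>" "sqrt 3 / \<kappa> < 1 / 8"
    using \<kappa> by (simp_all add: field_simps)
  have "0 < arctan (sqrt 3 / \<kappa>)" "arctan (sqrt 3 / \<kappa>) < 1 / 8"
    using s3 arctan_le_self[of "sqrt 3 / \<kappa>"] by (simp, linarith)
  then have \<theta>: "0 < \<theta>" "\<theta> < pi / 4"
    unfolding \<theta>_def using pi_gt3 by linarith+
  have w0: "M < w 0"
  proof -
    have "1 / \<kappa> < 1 / 199" using \<kappa> by (intro divide_strict_left_mono) auto
    then have "pi / 2 - 1 / 199 < arctan \<kappa>" using arctan_ge[of \<kappa>] \<kappa> by linarith
    then have "pi * M < pi * w 0"
      unfolding piM using piw[of 0] pi_less_4 pi_approx by (simp add: tan_45)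
    then show ?thesis by simp
  qed
  have w1: "w \<theta> < M"
  proof -
    have t: "tan (\<theta> / 2) = sqrt 3 / \<kappa>" by (simp add: \<theta>_def tan_arctan)
    have "arctan (sqrt 3) = pi / 3"
      using arctan_tan[of "pi / 3"] pi_gt_zero by (simp add: tan_60)
    moreover have "2 / 5 * (1 + 3 / \<kappa>\<^sup>2) < 41 / 100"
    proof -
      have "3 / \<kappa>\<^sup>2 < 3 / 199\<^sup>2"
        using \<kappa> by (intro divide_strict_left_mono power_strict_mono) auto
      then show ?thesis by simp
    qed
    moreover have "arctan (\<kappa> * tan (pi / 4 - \<theta> / 2)) < pi / 2" by (rule arctan_ubound)
    moreover have "pi * w \<theta> = 2 / 5 * (1 + 3 / \<kappa>\<^sup>2) + arctan (sqrt 3) + arctan (\<kappa> * tan (pi / 4 - \<theta> / 2))"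
      using piw[of \<theta>] \<theta> \<kappa> pi_gt_zero by (simp add: t power_divide)
    ultimately have "pi * w \<theta> < pi * M"
      unfolding piM using pi_gt3 by linarith
    then show ?thesis by simp
  qed
  have w2: "M < w (pi / 4)"
  proof -
    have "pi * w (pi / 4) = 8 / 5 * (1 + T\<^sup>2) / (1 + (\<kappa> * T)\<^sup>2) + arctan (\<kappa> * T) + arctan (\<kappa> * T)"
      using piw[of "pi / 4"] pi_gt_zero by (simp add: T_def)
    moreover have "0 \<le> 8 / 5 * (1 + T\<^sup>2) / (1 + (\<kappa> * T)\<^sup>2)" by (intro divide_nonneg_nonneg) auto
    ultimately have "pi * M < pi * w (pi / 4)" unfolding piM using arctanT by linarith
    then show ?thesis by simp
  qed
  have w3: "w (- (pi / 4)) < M"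
  proof -
    have "1 * T \<le> \<kappa> * T" using \<kappa> T by (intro mult_right_mono) auto
    then have "T\<^sup>2 \<le> (\<kappa> * T)\<^sup>2" using T by (intro power_mono) auto
    then have "(1 + T\<^sup>2) / (1 + (\<kappa> * T)\<^sup>2) \<le> 1" by (simp add: add_pos_nonneg)
    then have "8 / 5 * (1 + T\<^sup>2) / (1 + (\<kappa> * T)\<^sup>2) \<le> 8 / 5" by linarith
    moreover have "arctan (\<kappa> * tan (pi / 4 - - (pi / 4) / 2)) < pi / 2" by (rule arctan_ubound)
    moreover have "pi * w (- (pi / 4)) = 8 / 5 * (1 + T\<^sup>2) / (1 + (\<kappa> * T)\<^sup>2) - arctan (\<kappa> * T)
        + arctan (\<kappa> * tan (pi / 4 - - (pi / 4) / 2))"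
      using piw[of "- (pi / 4)"] pi_gt_zero by (simp add: T_def arctan_minus)
    ultimately have "pi * w (- (pi / 4)) < pi * M" unfolding piM using arctanT pi_gt3 by linarith
    then show ?thesis by simp
  qed
  have "\<not> circle_unimodal (poisson_kernel r \<psi> \<circledast> arc_with_atom g)"
  proof (rule not_circle_unimodalI[OF rep, of "\<psi> + 0" "\<psi> + \<theta>" "\<psi> + pi / 4" "\<psi> + 2 * pi + - (pi / 4)" "ennreal (k * M)"])
    show "\<forall>\<^sub>F t in nhds (\<psi> + 0). ennreal (k * M) < K (cis t)"
      using ev[of 0 M \<psi>] w0 M pi_gt_zero by simp
    show "\<forall>\<^sub>F t in nhds (\<psi> + pi / 4). ennreal (k * M) < K (cis t)"
      using ev[of "pi / 4" M \<psi>] w2 M pi_gt_zero by simp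
    show "\<forall>\<^sub>F t in nhds (\<psi> + \<theta>). K (cis t) < ennreal (k * M)"
      using ev[of \<theta> M \<psi>] w1 M \<theta> pi_gt_zero by simp
    show "\<forall>\<^sub>F t in nhds (\<psi> + 2 * pi + - (pi / 4)). K (cis t) < ennreal (k * M)"
      using ev[of "- (pi / 4)" M "\<psi> + 2 * pi"] w3 M pi_gt_zero by simp
  qed (use \<theta> pi_gt_zero in simp_all)
  then show ?thesis
    using circle_prob_arc_with_atom[OF g] circle_unimodal_arc_with_atom[OF g]
    by (auto simp: strongly_unimodal_def)
qed

theorem theorem1p2:
  shows "(\<forall>\<mu> \<nu>. circle_prob \<mu> \<and> circle_symmetric \<mu> \<and> circle_unimodal \<mu> \<and>
            circle_prob \<nu> \<and> circle_symmetric \<nu> \<and> circle_unimodal \<nu> \<longrightarrow>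
            circle_symmetric (\<mu> \<circledast> \<nu>) \<and> circle_unimodal (\<mu> \<circledast> \<nu>))
    \<and> (\<forall>\<phi> \<mu>. 0 < \<phi> \<and> \<phi> < pi / 2 \<and> circle_prob \<mu> \<and> circle_symmetric \<mu> \<and>
            (AE \<xi> in \<mu>. \<xi> \<in> cis ` {-\<phi>..\<phi>}) \<longrightarrow>
            (\<forall>r \<psi>. 0 < r \<and> r < cos \<phi> / 4 \<longrightarrow> circle_unimodal (poisson_kernel r \<psi> \<circledast> \<mu>)))
    \<and> (\<forall>r \<psi>. 0 < r \<and> r < 1 \<longrightarrow>
            (\<exists>f. continuous_density (poisson_kernel r \<psi> \<circledast> sym_bernoulli) f) \<and>
            (\<forall>f. continuous_density (poisson_kernel r \<psi> \<circledast> sym_bernoulli) f \<longrightarrow>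
               f (cis \<psi>) = f (- cis \<psi>) \<and>
               (\<forall>\<xi> \<in> sphere 0 1 - {cis \<psi>, - cis \<psi>}. f \<xi> < f (cis \<psi>))) \<and>
            \<not> circle_unimodal (poisson_kernel r \<psi> \<circledast> sym_bernoulli))
    \<and> (\<exists>r\<^sub>0. 0 < r\<^sub>0 \<and> r\<^sub>0 < 1 \<and>
            (\<forall>r \<psi>. r\<^sub>0 < r \<and> r < 1 \<longrightarrow> \<not> strongly_unimodal (poisson_kernel r \<psi>)))"
proof (intro conjI allI impI)
  show "circle_symmetric (\<mu> \<circledast> \<nu>)" "circle_unimodal (\<mu> \<circledast> \<nu>)"
    if "circle_prob \<mu> \<and> circle_symmetric \<mu> \<and> circle_unimodal \<mu> \<and>
      circle_prob \<nu> \<and> circle_symmetric \<nu> \<and> circle_unimodal \<nu>" for \<mu> \<nu>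
    using that circle_symmetric_conv circle_unimodal_conv_symmetric by blast+
  show "circle_unimodal (poisson_kernel r \<psi> \<circledast> \<mu>)"
    if "0 < \<phi> \<and> \<phi> < pi / 2 \<and> circle_prob \<mu> \<and> circle_symmetric \<mu> \<and> (AE \<xi> in \<mu>. \<xi> \<in> cis ` {-\<phi>..\<phi>})"
      and "0 < r \<and> r < cos \<phi> / 4" for \<phi> \<mu> r \<psi>
    using that circle_unimodal_poisson_conv by blast
  fix r \<psi> :: real assume r: "0 < r \<and> r < 1"
  show "\<exists>f. continuous_density (poisson_kernel r \<psi> \<circledast> sym_bernoulli) f"
    using r poisson_conv_sym_bernoulli by blast
  show "\<not> circle_unimodal (poisson_kernel r \<psi> \<circledast> sym_bernoulli)"
    using r not_circle_unimodal_poisson_conv_sym_bernoulli by blast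
  fix f assume f: "continuous_density (poisson_kernel r \<psi> \<circledast> sym_bernoulli) f"
  show "f (cis \<psi>) = f (- cis \<psi>)"
    using r f continuous_density_poisson_conv_sym_bernoulli(1) by blast
  show "\<forall>\<xi>\<in>sphere 0 1 - {cis \<psi>, - cis \<psi>}. f \<xi> < f (cis \<psi>)"
    using r f continuous_density_poisson_conv_sym_bernoulli(2) by blast
next
  show "\<exists>r\<^sub>0. 0 < r\<^sub>0 \<and> r\<^sub>0 < 1 \<and> (\<forall>r \<psi>. r\<^sub>0 < r \<and> r < 1 \<longrightarrow> \<not> strongly_unimodal (poisson_kernel r \<psi>))"
    using not_strongly_unimodal_poisson_kernel by (intro exI[of _ "99 / 100"]) auto
qed

end
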